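(* Let $p\ge q\ge 2$ be integers, $a,b\in\mathbb{C}$, and suppose that the map $F(z,w)=z^p+w^q+a\bar z+b\bar w$, regarded as a map $\mathbb{R}^4\to\mathbb{R}^2$, is an excellent map. Then the number of cusps of $F$ lies in the interval $[(p+1)(q-1),\,(p-1)(q+1)]$. In particular, if $p=q$ then $F$ has exactly $p^2-1$ cusps.
   Context: A smooth map $g:X^4\to Y^2$ is an excellent map if for every $x\in X$ there are local coordinates $(x_1,\dots,x_4)$ centered at $x$ and $(y_1,y_2)$ centered at $g(x)$ in which $g$ takes one of the forms: (1) $(x_1,x_2)$; (2) $(x_1,x_2^2+x_3^2+x_4^2)$ (definite fold); (3) $(x_1,x_2^2+x_3^2-x_4^2)$ (indefinite fold); (4) $(x_1,x_2^2\pm x_3^2+x_1x_4+x_4^3)$ (cusp). *)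

theory Defs
  imports "HOL-Analysis.Analysis"
begin

text \<open>Smoothness (C-infinity) via iterated directional derivatives: a map on an open
set is smooth iff all iterated directional derivatives exist and are continuous.\<close>

definition dderiv :: "('a::real_normed_vector \<Rightarrow> 'b::real_normed_vector) \<Rightarrow> 'a \<Rightarrow> 'a \<Rightarrow> 'b" where
  "dderiv f v x = vector_derivative (\<lambda>t::real. f (x + t *\<^sub>R v)) (at 0)"

fun iter_dderiv :: "'a::real_normed_vector list \<Rightarrow> ('a \<Rightarrow> 'b::real_normed_vector) \<Rightarrow> 'a \<Rightarrow> 'b" where
  "iter_dderiv [] f = f"
| "iter_dderiv (v # vs) f = (\<lambda>x. dderiv (iter_dderiv vs f) v x)"

definition smooth_on :: "'a::real_normed_vector set \<Rightarrow> ('a \<Rightarrow> 'b::real_normed_vector) \<Rightarrow> bool" where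
  "smooth_on S f \<longleftrightarrow> open S \<and>
     (\<forall>vs. continuous_on S (iter_dderiv vs f) \<and>
        (\<forall>v. \<forall>x\<in>S. (\<lambda>t::real. iter_dderiv vs f (x + t *\<^sub>R v)) differentiable (at 0)))"

definition diffeo_onto :: "'a::real_normed_vector set \<Rightarrow> 'b::real_normed_vector set \<Rightarrow> ('a \<Rightarrow> 'b) \<Rightarrow> bool" where
  "diffeo_onto U V \<phi> \<longleftrightarrow> bij_betw \<phi> U V \<and> smooth_on U \<phi> \<and> smooth_on V (inv_into U \<phi>)"

type_synonym R4 = "real \<times> real \<times> real \<times> real"
type_synonym R2 = "real \<times> real"

definition has_normal_form_at ::
  "('a::real_normed_vector \<Rightarrow> 'b::real_normed_vector) \<Rightarrow> (R4 \<Rightarrow> R2) \<Rightarrow> 'a \<Rightarrow> bool" where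
  "has_normal_form_at g N x \<longleftrightarrow>
     (\<exists>U U' W W' (\<phi>::'a \<Rightarrow> R4) (\<psi>::'b \<Rightarrow> R2).
        x \<in> U \<and> g x \<in> W \<and> diffeo_onto U U' \<phi> \<and> diffeo_onto W W' \<psi> \<and>
        \<phi> x = 0 \<and> \<psi> (g x) = 0 \<and> g ` U \<subseteq> W \<and>
        (\<forall>y\<in>U. \<psi> (g y) = N (\<phi> y)))"

definition regular_nf :: "R4 \<Rightarrow> R2" where
  "regular_nf = (\<lambda>(x1,x2,x3,x4). (x1, x2))"
definition def_fold_nf :: "R4 \<Rightarrow> R2" where
  "def_fold_nf = (\<lambda>(x1,x2,x3,x4). (x1, x2^2 + x3^2 + x4^2))"
definition indef_fold_nf :: "R4 \<Rightarrow> R2" where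
  "indef_fold_nf = (\<lambda>(x1,x2,x3,x4). (x1, x2^2 + x3^2 - x4^2))"
definition cusp_nf :: "real \<Rightarrow> R4 \<Rightarrow> R2" where
  "cusp_nf s = (\<lambda>(x1,x2,x3,x4). (x1, x2^2 + s * x3^2 + x1 * x4 + x4^3))"

definition is_cusp_point :: "('a::real_normed_vector \<Rightarrow> 'b::real_normed_vector) \<Rightarrow> 'a \<Rightarrow> bool" where
  "is_cusp_point g x \<longleftrightarrow> has_normal_form_at g (cusp_nf 1) x \<or> has_normal_form_at g (cusp_nf (-1)) x"

definition cusps :: "('a::real_normed_vector \<Rightarrow> 'b::real_normed_vector) \<Rightarrow> 'a set" where
  "cusps g = {x. is_cusp_point g x}"

definition excellent :: "(complex \<times> complex \<Rightarrow> complex) \<Rightarrow> bool" where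
  "excellent g \<longleftrightarrow> smooth_on UNIV g \<and>
     (\<forall>x. has_normal_form_at g regular_nf x \<or> has_normal_form_at g def_fold_nf x \<or>
          has_normal_form_at g indef_fold_nf x \<or> is_cusp_point g x)"

end

theory Submission
  imports Defs "HOL-Computational_Algebra.Polynomial"
begin

text \<open>
  The critical set of \<open>F\<close> consists of the points where \<open>p z\<^bsup>p-1\<^esup> = - cnj a u\<close> and
  \<open>q w\<^bsup>q-1\<^esup> = - cnj b u\<close> for a common \<open>u\<close> on the unit circle, so it is a union of curves
  parametrised by roots of \<open>u\<close>. Along such a curve the derivative of \<open>F\<close> is a nowhere vanishing factor
  times a real function of the form \<open>A cos (m t + \<alpha>) + B cos (n t + \<beta>)\<close> with \<open>m = (p+1)(q-1)\<close> and
  \<open>n = (p-1)(q+1)\<close>.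
  The normal forms show that along the critical curve the derivative of \<open>F\<close> is nonzero at folds and has a
  simple zero at cusps, so cusps correspond to the zeros of this trigonometric sum, all of them
  simple. Such a sum has at most \<open>2n\<close> zeros per period because it is a polynomial of degree \<open>2n\<close> in
  \<open>exp (i t)\<close>, and at least \<open>2m\<close> by the intermediate value theorem between the extrema of the cosine
  with the larger amplitude. If \<open>a = 0\<close> and \<open>p > 2\<close> (or \<open>b = 0\<close> and \<open>q > 2\<close>), then \<open>F\<close> is flat to second
  order along a real plane at some critical point that is not a cusp, which no fold permits.
\<close>

section \<open>Differentiability of smooth maps\<close>

text \<open>Mean value inequality on the segment from \<open>y\<close> to
  \<open>y + c *\<^sub>R v\<close>, where continuity of \<open>dderiv f v\<close> at
  \<open>x\<close> keeps the derivative within \<open>e\<close> of its value at \<open>x\<close>.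
  The base point \<open>y\<close> may vary near \<open>x\<close>, so that coordinates can later be
  changed one at a time.\<close>

lemma smooth_on_directional_bound:
  fixes f :: "'a::real_normed_vector \<Rightarrow> 'b::real_normed_vector"
  assumes "smooth_on S f" "x \<in> S" "e > 0"
  obtains d where "d > 0"
    "\<And>y c. norm (y - x) < d \<Longrightarrow> \<bar>c\<bar> < d \<Longrightarrow>
       norm (f (y + c *\<^sub>R v) - f y - c *\<^sub>R dderiv f v x) \<le> e * \<bar>c\<bar>"
proof -
  have S: "open S" and cont: "continuous_on S (dderiv f v)"
    and diff: "\<And>z. z \<in> S \<Longrightarrow> (\<lambda>t::real. f (z + t *\<^sub>R v)) differentiable (at 0)"
    using assms(1)[unfolded smooth_on_def]
    by (metis, metis (no_types, lifting) ext iter_dderiv.simps, metis iter_dderiv.simps(1))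
  obtain r1 where r1: "r1 > 0" "ball x r1 \<subseteq> S"
    using S assms(2) openE by blast
  have "isCont (dderiv f v) x"
    using cont S assms(2) continuous_on_eq_continuous_at by blast
  then obtain r2 where r2: "r2 > 0" "\<And>z. norm (z - x) < r2 \<Longrightarrow> norm (dderiv f v z - dderiv f v x) < e"
    using assms(3) unfolding continuous_at_eps_delta dist_norm by metis
  define r where "r = min r1 r2"
  \<comment> \<open>With this radius \<open>d * (1 + norm v) = r / 2\<close>, so the whole segment
    stays within \<open>r\<close> of \<open>x\<close>.\<close>
  define d where "d = r / (2 * (1 + norm v))"
  have r: "r > 0" using r1 r2 by (simp add: r_def)
  have nv: "1 + norm v > 0" by (smt (verit) norm_ge_zero)
  have d: "d > 0" using r nv by (simp add: d_def)
  have dr: "d + d * norm v < r"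
  proof -
    have "d * (1 + norm v) = r / 2" using nv by (simp add: d_def field_simps)
    then show ?thesis using r by (simp add: algebra_simps)
  qed
  show ?thesis
  proof (rule that[OF d])
    fix y c assume y: "norm (y - x) < d" and c: "\<bar>c\<bar> < d"
    have near: "norm (y + t *\<^sub>R v - x) < r" if "t \<in> closed_segment 0 c" for t
    proof -
      have "\<bar>t\<bar> \<le> \<bar>c\<bar>" using that by (auto simp: closed_segment_eq_real_ivl split: if_splits)
      then have "\<bar>t\<bar> * norm v \<le> d * norm v" using c by (intro mult_right_mono) auto
      moreover have "norm (y + t *\<^sub>R v - x) \<le> norm (y - x) + norm (t *\<^sub>R v)"
        by (metis add_diff_eq add.commute norm_triangle_ineq diff_add_eq)
      ultimately show ?thesis using y dr by simp
    qed
    let ?g = "\<lambda>t. f (y + t *\<^sub>R v) - t *\<^sub>R dderiv f v x"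
    have deriv: "(?g has_derivative (\<lambda>h. h *\<^sub>R (dderiv f v (y + t *\<^sub>R v) - dderiv f v x)))
        (at t within closed_segment 0 c)" if t: "t \<in> closed_segment 0 c" for t
    proof -
      have "y + t *\<^sub>R v \<in> S"
        using near[OF t] r1 by (auto simp: r_def dist_norm norm_minus_commute subset_iff)
      then have "((\<lambda>u::real. f (y + t *\<^sub>R v + u *\<^sub>R v)) has_vector_derivative dderiv f v (y + t *\<^sub>R v)) (at 0)"
        unfolding dderiv_def using diff vector_derivative_works by blast
      moreover have "((\<lambda>u. u - t) has_vector_derivative 1) (at t)"
        by (auto intro!: derivative_eq_intros)
      ultimately have "((\<lambda>u. f (y + t *\<^sub>R v + (u - t) *\<^sub>R v)) has_vector_derivative dderiv f v (y + t *\<^sub>R v)) (at t)"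
        using vector_diff_chain_at[of "\<lambda>u. u - t" 1 t "\<lambda>u::real. f (y + t *\<^sub>R v + u *\<^sub>R v)"]
        by (simp add: o_def)
      then have "((\<lambda>u. f (y + u *\<^sub>R v)) has_vector_derivative dderiv f v (y + t *\<^sub>R v)) (at t)"
        by (simp add: algebra_simps)
      then have "(?g has_vector_derivative (dderiv f v (y + t *\<^sub>R v) - dderiv f v x)) (at t)"
        by (auto intro!: derivative_eq_intros)
      then show ?thesis
        using has_vector_derivative_def has_derivative_at_withinI by blast
    qed
    have "norm (?g c - ?g 0) \<le> e * norm (c - 0)"
    proof (rule differentiable_bound[OF convex_closed_segment deriv])
      fix t assume t: "t \<in> closed_segment 0 c"
      have "norm (dderiv f v (y + t *\<^sub>R v) - dderiv f v x) \<le> e"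
        using r2(2)[of "y + t *\<^sub>R v"] near[OF t] by (simp add: r_def)
      then show "onorm (\<lambda>h. h *\<^sub>R (dderiv f v (y + t *\<^sub>R v) - dderiv f v x)) \<le> e"
        by (intro onorm_le) (simp add: mult.commute[of e] mult_left_mono)
    qed auto
    then show "norm (f (y + c *\<^sub>R v) - f y - c *\<^sub>R dderiv f v x) \<le> e * \<bar>c\<bar>"
      by (simp add: algebra_simps)
  qed
qed

text \<open>Continuous partial derivatives give Frechet differentiability: the increment is built up
  one coordinate at a time, each move being controlled by the preceding bound.\<close>

lemma smooth_on_imp_has_derivative:
  fixes f :: "'a::euclidean_space \<Rightarrow> 'b::real_normed_vector"
  assumes f: "smooth_on S f" and x: "x \<in> S"
  shows "(f has_derivative (\<lambda>h. \<Sum>i\<in>Basis. (h \<bullet> i) *\<^sub>R dderiv f i x)) (at x)"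
proof -
  \<comment> \<open>\<open>B\<close> collects the coordinates already moved; each adds an error of
    at most \<open>e * norm h\<close>, hence the factor \<open>card B\<close>.\<close>
  have key: "\<exists>d>0. \<forall>h. norm h < d \<longrightarrow>
      norm (f (x + (\<Sum>i\<in>B. (h \<bullet> i) *\<^sub>R i)) - f x - (\<Sum>i\<in>B. (h \<bullet> i) *\<^sub>R dderiv f i x)) \<le> e * (card B * norm h)"
    if "B \<subseteq> Basis" "e > 0" for B e
    using finite_subset[OF that(1) finite_Basis] that(1)
  proof (induction B rule: finite_induct)
    case empty
    then show ?case by (auto intro: exI[of _ 1])
  next
    case (insert k B)
    obtain d1 where d1: "d1 > 0" "\<And>h. norm h < d1 \<Longrightarrow>
      norm (f (x + (\<Sum>i\<in>B. (h \<bullet> i) *\<^sub>R i)) - f x - (\<Sum>i\<in>B. (h \<bullet> i) *\<^sub>R dderiv f i x)) \<le> e * (card B * norm h)"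
      using insert by auto
    obtain d2 where d2: "d2 > 0" "\<And>y c. norm (y - x) < d2 \<Longrightarrow> \<bar>c\<bar> < d2 \<Longrightarrow>
       norm (f (y + c *\<^sub>R k) - f y - c *\<^sub>R dderiv f k x) \<le> e * \<bar>c\<bar>"
      using smooth_on_directional_bound[OF f x \<open>e > 0\<close>, of k] by blast
    \<comment> \<open>The partially moved point lies within \<open>card B * norm h\<close> of
      \<open>x\<close>; the division keeps it, and the next coordinate increment, below
      \<open>d2\<close>.\<close>
    define d where "d = min d1 (d2 / (1 + card B))"
    show ?case
    proof (intro exI[of _ d] conjI allI impI)
      show "d > 0" using d1 d2 by (auto simp: d_def intro!: divide_pos_pos)
      fix h :: 'a assume h: "norm h < d"
      let ?y = "x + (\<Sum>i\<in>B. (h \<bullet> i) *\<^sub>R i)"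
      have hk: "\<bar>h \<bullet> k\<bar> \<le> norm h" using insert Basis_le_norm by blast
      have hd2: "norm h * (1 + card B) < d2"
        using h by (auto simp: d_def field_simps)
      have "norm (\<Sum>i\<in>B. (h \<bullet> i) *\<^sub>R i) \<le> (\<Sum>i\<in>B. norm h)"
      proof (rule sum_norm_le)
        fix i assume "i \<in> B"
        then have "i \<in> Basis" using insert by auto
        then show "norm ((h \<bullet> i) *\<^sub>R i) \<le> norm h" using Basis_le_norm[of i h] by simp
      qed
      then have "norm (?y - x) < d2"
        using hd2 by (simp add: algebra_simps) (smt (verit) norm_ge_zero)
      moreover have "\<bar>h \<bullet> k\<bar> < d2"
      proof -
        have "norm h * 1 \<le> norm h * (1 + card B)" by (intro mult_left_mono) auto
        then show ?thesis using hd2 hk by linarith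
      qed
      ultimately have "norm (f (?y + (h \<bullet> k) *\<^sub>R k) - f ?y - (h \<bullet> k) *\<^sub>R dderiv f k x) \<le> e * \<bar>h \<bullet> k\<bar>"
        by (rule d2)
      also have "\<dots> \<le> e * norm h" using hk that(2) by simp
      finally have 1: "norm (f (?y + (h \<bullet> k) *\<^sub>R k) - f ?y - (h \<bullet> k) *\<^sub>R dderiv f k x) \<le> e * norm h" .
      have 2: "norm (f ?y - f x - (\<Sum>i\<in>B. (h \<bullet> i) *\<^sub>R dderiv f i x)) \<le> e * (card B * norm h)"
        using d1 h by (simp add: d_def)
      have "f (x + (\<Sum>i\<in>insert k B. (h \<bullet> i) *\<^sub>R i)) - f x - (\<Sum>i\<in>insert k B. (h \<bullet> i) *\<^sub>R dderiv f i x)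
        = (f (?y + (h \<bullet> k) *\<^sub>R k) - f ?y - (h \<bullet> k) *\<^sub>R dderiv f k x) + (f ?y - f x - (\<Sum>i\<in>B. (h \<bullet> i) *\<^sub>R dderiv f i x))"
        using insert by (simp add: algebra_simps)
      then have "norm (f (x + (\<Sum>i\<in>insert k B. (h \<bullet> i) *\<^sub>R i)) - f x - (\<Sum>i\<in>insert k B. (h \<bullet> i) *\<^sub>R dderiv f i x))
        \<le> e * norm h + e * (card B * norm h)"
        using norm_triangle_mono[OF 1 2] by (simp only:)
      then show "norm (f (x + (\<Sum>i\<in>insert k B. (h \<bullet> i) *\<^sub>R i)) - f x - (\<Sum>i\<in>insert k B. (h \<bullet> i) *\<^sub>R dderiv f i x))
        \<le> e * (card (insert k B) * norm h)"
        using insert by (simp add: algebra_simps)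
    qed
  qed
  show ?thesis
    unfolding has_derivative_at_alt
  proof (intro conjI allI impI)
    show "bounded_linear (\<lambda>h. \<Sum>i\<in>Basis. (h \<bullet> i) *\<^sub>R dderiv f i x)"
      by (intro bounded_linear_sum bounded_linear_scaleR_const bounded_linear_inner_left)
    fix e :: real assume e: "e > 0"
    define e' where "e' = e / DIM('a)"
    have "e' > 0" using e by (simp add: e'_def)
    from key[OF order_refl this] obtain d where d: "d > 0" "\<And>h. norm h < d \<Longrightarrow>
      norm (f (x + h) - f x - (\<Sum>i\<in>Basis. (h \<bullet> i) *\<^sub>R dderiv f i x)) \<le> e' * (DIM('a) * norm h)"
      by (auto simp: euclidean_representation)
    show "\<exists>d>0. \<forall>y. norm (y - x) < d \<longrightarrow> norm (f y - f x - (\<Sum>i\<in>Basis. ((y - x) \<bullet> i) *\<^sub>R dderiv f i x)) \<le> e * norm (y - x)"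
    proof (intro exI[of _ d] conjI allI impI d(1))
      fix y assume "norm (y - x) < d"
      from d(2)[OF this] show "norm (f y - f x - (\<Sum>i\<in>Basis. ((y - x) \<bullet> i) *\<^sub>R dderiv f i x)) \<le> e * norm (y - x)"
        by (simp add: e'_def)
    qed
  qed
qed


text \<open>Both compositions of \<open>\<phi>\<close> with its inverse are the identity on open
  sets, so the chain rule and uniqueness of derivatives make \<open>D\<close> and \<open>E\<close>
  mutually inverse.\<close>

lemma diffeo_onto_derivative:
  fixes \<phi> :: "'a::euclidean_space \<Rightarrow> 'b::euclidean_space"
  assumes "diffeo_onto U V \<phi>" "x \<in> U"
  obtains D E where "(\<phi> has_derivative D) (at x)" "(inv_into U \<phi> has_derivative E) (at (\<phi> x))"
    "\<And>h. E (D h) = h" "\<And>k. D (E k) = k"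
proof -
  let ?\<kappa> = "inv_into U \<phi>"
  have bij: "bij_betw \<phi> U V" and sm: "smooth_on U \<phi>" "smooth_on V ?\<kappa>"
    using assms(1) by (auto simp: diffeo_onto_def)
  then have op: "open U" "open V" by (auto simp: smooth_on_def)
  have y: "\<phi> x \<in> V" and inv: "?\<kappa> (\<phi> x) = x"
    using bij assms(2) by (auto simp: bij_betw_def inv_into_f_f)
  obtain D E where D: "(\<phi> has_derivative D) (at x)" and E: "(?\<kappa> has_derivative E) (at (\<phi> x))"
    using smooth_on_imp_has_derivative sm y assms(2) by meson
  have "(?\<kappa> \<circ> \<phi> has_derivative E \<circ> D) (at x)" using diff_chain_at[OF D E] .
  then have "((\<lambda>x. x) has_derivative E \<circ> D) (at x)"
    by (rule has_derivative_transform_within_open[OF _ op(1) assms(2)])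
       (use bij in \<open>auto simp: bij_betw_def inv_into_f_f\<close>)
  then have ED: "E \<circ> D = (\<lambda>h. h)" using has_derivative_unique has_derivative_ident by metis
  have "(\<phi> \<circ> ?\<kappa> has_derivative D \<circ> E) (at (\<phi> x))" using diff_chain_at[OF E] D inv by simp
  then have "((\<lambda>x. x) has_derivative D \<circ> E) (at (\<phi> x))"
    by (rule has_derivative_transform_within_open[OF _ op(2) y])
       (use bij in \<open>auto simp: bij_betw_def f_inv_into_f\<close>)
  then have DE: "D \<circ> E = (\<lambda>h. h)" using has_derivative_unique has_derivative_ident by metis
  show ?thesis by (rule that[OF D E]) (use ED DE in \<open>auto simp: fun_eq_iff\<close>)
qed

section \<open>Normal forms along critical curves\<close>

text \<open>The linear part scales with \<open>r\<close>, and the remainder is small relative to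
  \<open>norm (y t - x)\<close>, hence to \<open>r t\<close>. Keeping the scale separate from the
  path lets the same rule serve limits of first and of second order.\<close>

lemma has_derivative_scaled_limit:
  fixes f :: "'a::real_normed_vector \<Rightarrow> 'b::real_normed_vector" and r :: "'c \<Rightarrow> real"
  assumes f: "(f has_derivative D) (at x)" and pos: "eventually (\<lambda>t. r t > 0) F"
    and r: "(r \<longlongrightarrow> 0) F" and y: "((\<lambda>t. (y t - x) /\<^sub>R r t) \<longlongrightarrow> v) F"
  shows "((\<lambda>t. (f (y t) - f x) /\<^sub>R r t) \<longlongrightarrow> D v) F"
proof -
  interpret D: bounded_linear D using f by (rule has_derivative_bounded_linear)
  \<comment> \<open>Relative error of the linear approximation. Division by zero gives
    \<open>\<epsilon> x = 0\<close>, so \<open>\<epsilon>\<close> is continuous at \<open>x\<close>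
    and may be composed with \<open>y\<close> even where \<open>y t = x\<close>.\<close>
  define \<epsilon> where "\<epsilon> z = (f z - f x - D (z - x)) /\<^sub>R norm (z - x)" for z
  have "(\<epsilon> \<longlongrightarrow> \<epsilon> x) (at x)"
    using f unfolding has_derivative_at_within \<epsilon>_def by (simp add: D.zero)
  moreover have "((\<lambda>t. r t *\<^sub>R ((y t - x) /\<^sub>R r t)) \<longlongrightarrow> 0 *\<^sub>R v) F"
    by (intro tendsto_intros r y)
  then have "((\<lambda>t. y t - x) \<longlongrightarrow> 0) F"
    unfolding scale_zero_left
    by (rule Lim_transform_eventually) (use pos in \<open>auto elim!: eventually_mono\<close>)
  then have "(y \<longlongrightarrow> x) F" using Lim_null by blast
  ultimately have "((\<lambda>t. \<epsilon> (y t)) \<longlongrightarrow> \<epsilon> x) F"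
    by (simp add: isCont_def isCont_tendsto_compose)
  then have "((\<lambda>t. D ((y t - x) /\<^sub>R r t) + norm ((y t - x) /\<^sub>R r t) *\<^sub>R \<epsilon> (y t)) \<longlongrightarrow> D v + norm v *\<^sub>R \<epsilon> x) F"
    by (intro tendsto_intros D.tendsto y)
  moreover have "\<epsilon> x = 0" by (simp add: \<epsilon>_def)
  ultimately have "((\<lambda>t. D ((y t - x) /\<^sub>R r t) + norm ((y t - x) /\<^sub>R r t) *\<^sub>R \<epsilon> (y t)) \<longlongrightarrow> D v) F"
    by simp
  then show ?thesis
  proof (rule Lim_transform_eventually)
    show "eventually (\<lambda>t. D ((y t - x) /\<^sub>R r t) + norm ((y t - x) /\<^sub>R r t) *\<^sub>R \<epsilon> (y t) = (f (y t) - f x) /\<^sub>R r t) F"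
      using pos
    proof eventually_elim
      case (elim t)
      have "norm (y t - x) *\<^sub>R \<epsilon> (y t) = f (y t) - f x - D (y t - x)"
        by (cases "y t = x") (auto simp: \<epsilon>_def D.zero)
      moreover have "norm ((y t - x) /\<^sub>R r t) *\<^sub>R \<epsilon> (y t) = (norm (y t - x) *\<^sub>R \<epsilon> (y t)) /\<^sub>R r t"
        using elim by simp
      ultimately have "norm ((y t - x) /\<^sub>R r t) *\<^sub>R \<epsilon> (y t) = (f (y t) - f x - D (y t - x)) /\<^sub>R r t"
        by (simp only:)
      moreover have "D ((y t - x) /\<^sub>R r t) = D (y t - x) /\<^sub>R r t" by (rule D.scaleR)
      ultimately show ?case by (simp only: flip: scaleR_add_right) simp
    qed
  qed
qed

lemma has_vector_derivative_transform_nhds: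
  assumes "(f has_vector_derivative d) (at t)" "eventually (\<lambda>u. f u = g u) (nhds t)"
  shows "(g has_vector_derivative d) (at t)"
  using assms has_vector_derivative_cong_ev[of UNIV f g t d] eventually_nhds_x_imp_x by force

text \<open>The chain rule through both charts conjugates the derivative of \<open>g\<close> to that
  of \<open>N\<close> at every point of \<open>U\<close>, so surjectivity can be read off the normal
  form. \<open>\<kappa>\<close> is the local inverse of \<open>\<psi>\<close>, which recovers
  \<open>g\<close> from \<open>N\<close>.\<close>

lemma normal_form_charts:
  fixes g :: "'a::euclidean_space \<Rightarrow> 'b::euclidean_space"
  assumes "has_normal_form_at g N x"
  obtains U \<phi> \<psi> \<kappa> D E P Q where "open U" "x \<in> U" "\<phi> x = 0" "\<psi> (g x) = 0"
    "\<forall>y\<in>U. \<psi> (g y) = N (\<phi> y)" "\<forall>y\<in>U. g y = \<kappa> (N (\<phi> y))"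
    "(\<phi> has_derivative D) (at x)" "\<forall>h. E (D h) = h" "\<forall>k. D (E k) = k"
    "(\<psi> has_derivative P) (at (g x))" "(\<kappa> has_derivative Q) (at 0)" "\<forall>h. Q (P h) = h" "\<forall>k. P (Q k) = k"
    "\<forall>y\<in>U. \<forall>G N'. (g has_derivative G) (at y) \<longrightarrow> (N has_derivative N') (at (\<phi> y)) \<longrightarrow> surj G = surj N'"
proof -
  obtain U U' W W' and \<phi> :: "'a \<Rightarrow> R4" and \<psi> :: "'b \<Rightarrow> R2" where
    H: "x \<in> U \<and> g x \<in> W \<and> diffeo_onto U U' \<phi> \<and> diffeo_onto W W' \<psi> \<and>
      \<phi> x = 0 \<and> \<psi> (g x) = 0 \<and> g ` U \<subseteq> W \<and> (\<forall>y\<in>U. \<psi> (g y) = N (\<phi> y))"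
    using assms[unfolded has_normal_form_at_def] by (elim exE) (rule that)
  then have *: "x \<in> U" "g x \<in> W" and d1: "diffeo_onto U U' \<phi>" and d2: "diffeo_onto W W' \<psi>" and
    **: "\<phi> x = 0" "\<psi> (g x) = 0" "g ` U \<subseteq> W" "\<And>y. y \<in> U \<Longrightarrow> \<psi> (g y) = N (\<phi> y)"
    by simp_all
  have U: "open U" using d1 by (auto simp: diffeo_onto_def smooth_on_def)
  have inj: "inj_on \<psi> W" using d2 by (auto simp: diffeo_onto_def bij_betw_def)
  obtain D E where DE: "(\<phi> has_derivative D) (at x)" "\<And>h. E (D h) = h" "\<And>k. D (E k) = k"
    using diffeo_onto_derivative[OF d1 *(1)] by metis
  obtain P Q where PQ: "(\<psi> has_derivative P) (at (g x))" "(inv_into W \<psi> has_derivative Q) (at 0)"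
    "\<And>h. Q (P h) = h" "\<And>k. P (Q k) = k"
    using diffeo_onto_derivative[OF d2 *(2)] **(2) by metis
  have g: "g y = inv_into W \<psi> (N (\<phi> y))" if "y \<in> U" for y
    using that **(3,4) inj by (metis image_subset_iff inv_into_f_f)
  have surj: "surj G = surj N'" if y: "y \<in> U" and G: "(g has_derivative G) (at y)"
    and N': "(N has_derivative N') (at (\<phi> y))" for y G N'
  proof -
    obtain D E where D: "(\<phi> has_derivative D) (at y)" "\<And>h. E (D h) = h" "\<And>k. D (E k) = k"
      using diffeo_onto_derivative[OF d1 y] by metis
    have "g y \<in> W" using y ** by auto
    then obtain P Q where P: "(\<psi> has_derivative P) (at (g y))" "\<And>h. Q (P h) = h" "\<And>k. P (Q k) = k"
      using diffeo_onto_derivative[OF d2] by metis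
    have "(\<psi> \<circ> g has_derivative P \<circ> G) (at y)" using diff_chain_at[OF G P(1)] .
    then have "(N \<circ> \<phi> has_derivative P \<circ> G) (at y)"
      by (rule has_derivative_transform_within_open[OF _ U y]) (use ** in auto)
    then have eq: "P \<circ> G = N' \<circ> D"
      using has_derivative_unique diff_chain_at[OF D(1) N'] by blast
    then have PG: "P (G h) = N' (D h)" for h by (metis comp_apply)
    show ?thesis
    proof
      assume "surj G"
      then have "k \<in> range N'" for k using PG P(3)[of k] by (metis rangeI surjD)
      then show "surj N'" by blast
    next
      assume "surj N'"
      then have "k \<in> range G" for k using PG P(2) D(3) by (metis rangeI surjD)
      then show "surj G" by blast
    qed
  qed
  show ?thesis
    by (rule that[of U \<phi> \<psi> "inv_into W \<psi>" D E P Q, OF U *(1) **(1,2) _ _ DE(1) _ _ PQ(1,2)])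
       (use **(4) g DE PQ surj in auto)
qed

section \<open>Derivatives and singular points of the normal forms\<close>

text \<open>A single family for both fold types, \<open>e = 1\<close> and \<open>e = -1\<close>, so
  that one argument treats them together.\<close>

definition fold_nf :: "real \<Rightarrow> R4 \<Rightarrow> R2" where
  "fold_nf e = (\<lambda>(x1, x2, x3, x4). (x1, x2\<^sup>2 + x3\<^sup>2 + e * x4\<^sup>2))"

lemma def_fold_nf_eq: "def_fold_nf = fold_nf 1" and indef_fold_nf_eq: "indef_fold_nf = fold_nf (-1)"
  by (auto simp: def_fold_nf_def indef_fold_nf_def fold_nf_def fun_eq_iff)

lemma has_derivative_regular_nf: "(regular_nf has_derivative regular_nf) (at X)"
  unfolding regular_nf_def case_prod_beta by (auto intro!: derivative_eq_intros)

lemma has_derivative_fold_nf: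
  "(fold_nf e has_derivative (\<lambda>(h1, h2, h3, h4). (h1, 2 * x2 * h2 + 2 * x3 * h3 + 2 * e * x4 * h4)))
    (at (x1, x2, x3, x4))"
  unfolding fold_nf_def case_prod_beta
  by (auto intro!: derivative_eq_intros simp: fun_eq_iff algebra_simps)

lemma has_derivative_cusp_nf:
  "(cusp_nf s has_derivative
     (\<lambda>(h1, h2, h3, h4). (h1, 2 * x2 * h2 + 2 * s * x3 * h3 + x4 * h1 + (x1 + 3 * x4\<^sup>2) * h4)))
    (at (x1, x2, x3, x4))"
  unfolding cusp_nf_def case_prod_beta
  by (auto intro!: derivative_eq_intros simp: fun_eq_iff algebra_simps)

text \<open>The derivatives of the fold and cusp forms share this shape. The first component copies
  \<open>h1\<close>, so the map is onto exactly when the second still varies on the hyperplane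
  \<open>h1 = 0\<close>.\<close>

lemma surj_shear_iff:
  fixes k a b c :: real
  shows "surj (\<lambda>(h1, h2, h3, h4). (h1 :: real, a * h2 + b * h3 + k * h1 + c * h4)) \<longleftrightarrow> a \<noteq> 0 \<or> b \<noteq> 0 \<or> c \<noteq> 0"
proof
  assume "surj (\<lambda>(h1, h2, h3, h4). (h1 :: real, a * h2 + b * h3 + k * h1 + c * h4))"
  then obtain h where "(0, 1) = (case h of (h1, h2, h3, h4) \<Rightarrow> (h1 :: real, a * h2 + b * h3 + k * h1 + c * h4))"
    by (rule surjE)
  then show "a \<noteq> 0 \<or> b \<noteq> 0 \<or> c \<noteq> 0" by (cases h) auto
next
  assume *: "a \<noteq> 0 \<or> b \<noteq> 0 \<or> c \<noteq> 0"
  \<comment> \<open>Squared length of \<open>(a, b, c)\<close>; a preimage of \<open>(u, v)\<close>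
    is found by moving along this vector.\<close>
  define N where "N = a\<^sup>2 + b\<^sup>2 + c\<^sup>2"
  have N: "N \<noteq> 0" using * unfolding N_def
    by (smt (verit) zero_le_power2 power2_eq_square mult_eq_0_iff)
  show "surj (\<lambda>(h1, h2, h3, h4). (h1 :: real, a * h2 + b * h3 + k * h1 + c * h4))"
    unfolding surj_def
  proof
    fix y :: "real \<times> real"
    obtain u v where y: "y = (u, v)" by (cases y)
    let ?t = "(v - k * u) / N"
    have "a * (a * ?t) + b * (b * ?t) + k * u + c * (c * ?t) = N * ?t + k * u"
      by (simp only: N_def power2_eq_square distrib_right mult.assoc)
    also have "\<dots> = v" using N by simp
    finally show "\<exists>x. y = (case x of (h1, h2, h3, h4) \<Rightarrow> (h1, a * h2 + b * h3 + k * h1 + c * h4))"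
      by (intro exI[of _ "(u, a * ?t, b * ?t, c * ?t)"]) (simp add: y)
  qed
qed

text \<open>For \<open>e \<noteq> 0\<close> this identifies the singular set as the
  \<open>x1\<close>-axis.\<close>

lemma fold_nf_singular:
  obtains N' where "(fold_nf e has_derivative N') (at (x1, x2, x3, x4))"
    "surj N' \<longleftrightarrow> x2 \<noteq> 0 \<or> x3 \<noteq> 0 \<or> e * x4 \<noteq> 0"
  using that[OF has_derivative_fold_nf] surj_shear_iff[of "2 * x2" "2 * x3" 0 "2 * e * x4"] by simp

text \<open>For \<open>s \<noteq> 0\<close> the singular set is the parabola
  \<open>(- 3 * c^2, 0, 0, c)\<close>, tangent to the \<open>x4\<close>-axis at the origin.\<close>

lemma cusp_nf_singular:
  obtains N' where "(cusp_nf s has_derivative N') (at (x1, x2, x3, x4))"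
    "surj N' \<longleftrightarrow> x2 \<noteq> 0 \<or> s * x3 \<noteq> 0 \<or> x1 \<noteq> - 3 * x4\<^sup>2"
  using that[OF has_derivative_cusp_nf] surj_shear_iff[of "2 * x2" "2 * s * x3" x4 "x1 + 3 * x4\<^sup>2"]
  by (simp add: eq_neg_iff_add_eq_0)

lemma regular_point_surj:
  fixes g :: "'a::euclidean_space \<Rightarrow> 'b::euclidean_space"
  assumes "has_normal_form_at g regular_nf x" "(g has_derivative G) (at x)"
  shows "surj G"
proof -
  have "surj regular_nf"
    unfolding regular_nf_def surj_def by (auto simp: case_prod_beta)
  then show ?thesis
    using normal_form_charts[OF assms(1)] assms(2) has_derivative_regular_nf by metis
qed

lemma cusp_point_not_surj:
  fixes g :: "'a::euclidean_space \<Rightarrow> 'b::euclidean_space"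
  assumes "has_normal_form_at g (cusp_nf s) x" "(g has_derivative G) (at x)"
  shows "\<not> surj G"
proof -
  obtain N' where "(cusp_nf s has_derivative N') (at 0)" "\<not> surj N'"
    using cusp_nf_singular[of s 0 0 0 0] by (auto simp: zero_prod_def)
  then show ?thesis
    using normal_form_charts[OF assms(1)] assms(2) by metis
qed

text \<open>The charts have invertible derivatives, so a vanishing derivative of \<open>g\<close>
  would make that of \<open>N\<close> vanish as well. This serves to exclude
  \<open>a = b = 0\<close>.\<close>

lemma normal_form_derivative_nonzero:
  fixes g :: "'a::euclidean_space \<Rightarrow> 'b::euclidean_space"
  assumes nf: "has_normal_form_at g N x" and G: "(g has_derivative G) (at x)"
    and N': "(N has_derivative N') (at 0)" "N' k \<noteq> 0"
  shows "G \<noteq> (\<lambda>h. 0)"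
proof
  assume 0: "G = (\<lambda>h. 0)"
  obtain U \<phi> \<psi> D E P where U: "open U" "x \<in> U" "\<phi> x = 0" "\<forall>y\<in>U. \<psi> (g y) = N (\<phi> y)"
    and D: "(\<phi> has_derivative D) (at x)" "\<forall>k. D (E k) = k" and P: "(\<psi> has_derivative P) (at (g x))"
    by (rule normal_form_charts[OF nf]) (rule that; assumption)
  have "(\<psi> \<circ> g has_derivative P \<circ> G) (at x)" using diff_chain_at[OF G P] .
  then have "(N \<circ> \<phi> has_derivative P \<circ> G) (at x)"
    by (rule has_derivative_transform_within_open[OF _ U(1,2)]) (use U in auto)
  moreover have "(N \<circ> \<phi> has_derivative N' \<circ> D) (at x)"
    using diff_chain_at[OF D(1)] N' U by simp
  ultimately have "P \<circ> G = N' \<circ> D" using has_derivative_unique by blast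
  then have "N' k = P (G (E k))" using D(2) by (metis comp_apply)
  also have "\<dots> = 0" using 0 P has_derivative_bounded_linear linear_simps(3) by fastforce
  finally show False using N' by simp
qed

section \<open>Critical curves through folds and cusps\<close>

text \<open>In the chart the curve runs in the \<open>x1\<close>-axis, which the fold form maps
  injectively and linearly to \<open>(x1, 0)\<close>. If the image had velocity zero, then so would
  the curve.\<close>

lemma fold_point_curve_immersed:
  fixes g :: "'a::euclidean_space \<Rightarrow> 'b::euclidean_space" and \<gamma> :: "real \<Rightarrow> 'a"
  assumes nf: "has_normal_form_at g (fold_nf e) (\<gamma> t0)" and e: "e \<noteq> 0"
    and \<gamma>: "(\<gamma> has_vector_derivative \<gamma>') (at t0)" "\<gamma>' \<noteq> 0"
    and sing: "\<And>t. \<exists>G. (g has_derivative G) (at (\<gamma> t)) \<and> \<not> surj G"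
    and d: "((\<lambda>t. g (\<gamma> t)) has_vector_derivative d) (at t0)"
  shows "d \<noteq> 0"
proof
  assume 0: "d = 0"
  obtain U \<phi> \<psi> D E P where U: "open U" "\<gamma> t0 \<in> U" "\<forall>y\<in>U. \<psi> (g y) = fold_nf e (\<phi> y)"
    and D: "(\<phi> has_derivative D) (at (\<gamma> t0))" "\<forall>h. E (D h) = h"
    and P: "(\<psi> has_derivative P) (at (g (\<gamma> t0)))"
    and surj: "\<forall>y\<in>U. \<forall>G N'. (g has_derivative G) (at y) \<longrightarrow> (fold_nf e has_derivative N') (at (\<phi> y)) \<longrightarrow> surj G = surj N'"
    by (rule normal_form_charts[OF nf]) (rule that; assumption)
  interpret D: bounded_linear D using D(1) by (rule has_derivative_bounded_linear)
  interpret P: bounded_linear P using P(1) by (rule has_derivative_bounded_linear)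
  have "isCont \<gamma> t0" using \<gamma>(1) has_vector_derivative_continuous by blast
  then have ev: "eventually (\<lambda>t. \<gamma> t \<in> U) (nhds t0)"
    using U(1,2) topological_tendstoD[of \<gamma> "\<gamma> t0" "at t0" U]
    by (simp add: isCont_def eventually_nhds_conv_at)
  have c0: "snd (\<phi> (\<gamma> t)) = 0" if "\<gamma> t \<in> U" for t
  proof -
    obtain x1 x2 x3 x4 where c: "\<phi> (\<gamma> t) = (x1, x2, x3, x4)" by (cases "\<phi> (\<gamma> t)")
    obtain N' where N': "(fold_nf e has_derivative N') (at (x1, x2, x3, x4))"
      "surj N' \<longleftrightarrow> x2 \<noteq> 0 \<or> x3 \<noteq> 0 \<or> e * x4 \<noteq> 0"
      by (rule fold_nf_singular)
    obtain G where "(g has_derivative G) (at (\<gamma> t))" "\<not> surj G" using sing by blast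
    then have "\<not> surj N'" using surj that N'(1) c by metis
    then show ?thesis using N'(2) e c by (simp add: zero_prod_def)
  qed
  have \<phi>\<gamma>: "((\<lambda>t. \<phi> (\<gamma> t)) has_vector_derivative D \<gamma>') (at t0)"
    using vector_derivative_diff_chain_within[of \<gamma> \<gamma>' t0 UNIV \<phi> D] \<gamma>(1) D(1)
    by (simp add: o_def has_derivative_at_withinI)
  have "((\<lambda>t. snd (\<phi> (\<gamma> t))) has_vector_derivative snd (D \<gamma>')) (at t0)"
    using bounded_linear.has_vector_derivative[OF bounded_linear_snd \<phi>\<gamma>] .
  moreover have "((\<lambda>t. snd (\<phi> (\<gamma> t))) has_vector_derivative 0) (at t0)"
    using has_vector_derivative_const[of "0 :: real \<times> real \<times> real" "at t0"]
    by (rule has_vector_derivative_transform_nhds) (use ev c0 in \<open>auto elim!: eventually_mono\<close>)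
  ultimately have snd0: "snd (D \<gamma>') = 0" using vector_derivative_unique_at by blast
  have "((\<lambda>t. \<psi> (g (\<gamma> t))) has_vector_derivative P d) (at t0)"
    using vector_derivative_diff_chain_within[of "\<lambda>t. g (\<gamma> t)" d t0 UNIV \<psi> P] d P
    by (simp add: o_def has_derivative_at_withinI)
  then have "((\<lambda>t. fst (\<psi> (g (\<gamma> t)))) has_vector_derivative fst (P d)) (at t0)"
    by (rule bounded_linear.has_vector_derivative[OF bounded_linear_fst])
  moreover have "((\<lambda>t. fst (\<phi> (\<gamma> t))) has_vector_derivative fst (D \<gamma>')) (at t0)"
    using bounded_linear.has_vector_derivative[OF bounded_linear_fst \<phi>\<gamma>] .
  then have "((\<lambda>t. fst (\<psi> (g (\<gamma> t)))) has_vector_derivative fst (D \<gamma>')) (at t0)"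
    by (rule has_vector_derivative_transform_nhds)
       (use ev U(3) in \<open>auto elim!: eventually_mono simp: fold_nf_def case_prod_beta\<close>)
  ultimately have "fst (D \<gamma>') = fst (P d)" using vector_derivative_unique_at by blast
  then have "D \<gamma>' = 0" using snd0 0 P.zero by (simp add: prod_eq_iff)
  then show False using D(2) D.zero \<gamma>(2) by metis
qed

text \<open>In the chart the curve is \<open>(- 3 * c^2, 0, 0, c)\<close> and its image is the
  semicubical parabola \<open>(- 3 * c^2, - 2 * c^3)\<close>. Since \<open>c\<close> has a simple
  zero, the leading term is quadratic with nonzero coefficient, and the target chart preserves
  this.\<close>

lemma cusp_point_curve_quadratic:
  fixes g :: "'a::euclidean_space \<Rightarrow> 'b::euclidean_space" and \<gamma> :: "real \<Rightarrow> 'a"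
  assumes nf: "has_normal_form_at g (cusp_nf s) (\<gamma> t0)" and s: "s \<noteq> 0"
    and \<gamma>: "(\<gamma> has_vector_derivative \<gamma>') (at t0)" "\<gamma>' \<noteq> 0"
    and sing: "\<And>t. \<exists>G. (g has_derivative G) (at (\<gamma> t)) \<and> \<not> surj G"
  obtains C where "C \<noteq> 0" "((\<lambda>t. (g (\<gamma> t) - g (\<gamma> t0)) /\<^sub>R (t - t0)\<^sup>2) \<longlongrightarrow> C) (at t0)"
proof -
  obtain U \<phi> \<psi> \<kappa> D E P Q where U: "open U" "\<gamma> t0 \<in> U" "\<phi> (\<gamma> t0) = 0" "\<forall>y\<in>U. g y = \<kappa> (cusp_nf s (\<phi> y))"
    and D: "(\<phi> has_derivative D) (at (\<gamma> t0))" "\<forall>h. E (D h) = h"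
    and P: "(\<psi> has_derivative P) (at (g (\<gamma> t0)))" and Q: "(\<kappa> has_derivative Q) (at 0)" "\<forall>k. P (Q k) = k"
    and surj: "\<forall>y\<in>U. \<forall>G N'. (g has_derivative G) (at y) \<longrightarrow> (cusp_nf s has_derivative N') (at (\<phi> y)) \<longrightarrow> surj G = surj N'"
    by (rule normal_form_charts[OF nf]) (rule that; assumption)
  interpret D: bounded_linear D using D(1) by (rule has_derivative_bounded_linear)
  interpret Q: bounded_linear Q using Q(1) by (rule has_derivative_bounded_linear)
  have "isCont \<gamma> t0" using \<gamma>(1) has_vector_derivative_continuous by blast
  then have ev: "eventually (\<lambda>t. \<gamma> t \<in> U) (nhds t0)"
    using U(1,2) topological_tendstoD[of \<gamma> "\<gamma> t0" "at t0" U]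
    by (simp add: isCont_def eventually_nhds_conv_at)
  define c where "c t = snd (snd (snd (\<phi> (\<gamma> t))))" for t
  have c: "\<phi> (\<gamma> t) = (- 3 * (c t)\<^sup>2, 0, 0, c t)" if "\<gamma> t \<in> U" for t
  proof -
    obtain x1 x2 x3 x4 where c: "\<phi> (\<gamma> t) = (x1, x2, x3, x4)" by (cases "\<phi> (\<gamma> t)")
    obtain N' where N': "(cusp_nf s has_derivative N') (at (x1, x2, x3, x4))"
      "surj N' \<longleftrightarrow> x2 \<noteq> 0 \<or> s * x3 \<noteq> 0 \<or> x1 \<noteq> - 3 * x4\<^sup>2"
      by (rule cusp_nf_singular)
    obtain G where "(g has_derivative G) (at (\<gamma> t))" "\<not> surj G" using sing by blast
    then have "\<not> surj N'" using surj that N'(1) c by metis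
    then show ?thesis using N'(2) s c by (simp add: c_def)
  qed
  have c0: "c t0 = 0" using U(3) by (simp add: c_def)
  have \<phi>\<gamma>: "((\<lambda>t. \<phi> (\<gamma> t)) has_vector_derivative D \<gamma>') (at t0)"
    using vector_derivative_diff_chain_within[of \<gamma> \<gamma>' t0 UNIV \<phi> D] \<gamma>(1) D(1)
    by (simp add: o_def has_derivative_at_withinI)
  define k where "k = snd (snd (snd (D \<gamma>')))"
  have "(c has_vector_derivative k) (at t0)"
    unfolding c_def k_def
    by (intro bounded_linear.has_vector_derivative[OF bounded_linear_snd] \<phi>\<gamma>)
  then have ck: "(c has_real_derivative k) (at t0)"
    by (simp add: has_real_derivative_iff_has_vector_derivative)
  then have "((\<lambda>t. - 3 * (c t)\<^sup>2) has_real_derivative 0) (at t0)"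
    using c0 by (auto intro!: derivative_eq_intros)
  then have "((\<lambda>t. (- 3 * (c t)\<^sup>2, 0 :: real, 0 :: real, c t)) has_vector_derivative (0, 0, 0, k)) (at t0)"
    using ck unfolding has_real_derivative_iff_has_vector_derivative
    by (intro has_vector_derivative_Pair has_vector_derivative_const)
  then have "((\<lambda>t. \<phi> (\<gamma> t)) has_vector_derivative (0, 0, 0, k)) (at t0)"
    by (rule has_vector_derivative_transform_nhds)
       (use ev c in \<open>auto elim!: eventually_mono\<close>)
  then have "D \<gamma>' = (0, 0, 0, k)" using \<phi>\<gamma> vector_derivative_unique_at by blast
  \<comment> \<open>The coordinate \<open>- 3 * c^2\<close> has zero velocity because
    \<open>c t0 = 0\<close>, so the nonzero vector \<open>D \<gamma>'\<close> has only its last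
    entry left.\<close>
  then have k: "k \<noteq> 0"
    using D(2) D.zero \<gamma>(2) unfolding zero_prod_def by metis
  \<comment> \<open>The second entry is \<open>x1 * x4 + x4^3 = - 3 * c^3 + c^3\<close> on the
    singular curve.\<close>
  let ?y = "\<lambda>t. (- 3 * (c t)\<^sup>2, - 2 * (c t) ^ 3)"
  have lim: "((\<lambda>t. c t / (t - t0)) \<longlongrightarrow> k) (at t0)"
    using ck c0 by (simp add: has_field_derivative_iff)
  have c_lim: "(c \<longlongrightarrow> 0) (at t0)"
    using DERIV_isCont[OF ck] c0 by (simp add: isCont_def)
  have "((\<lambda>t. (- 3 * (c t / (t - t0))\<^sup>2, - 2 * (c t / (t - t0))\<^sup>2 * c t)) \<longlongrightarrow> (- 3 * k\<^sup>2, - 2 * k\<^sup>2 * 0)) (at t0)"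
    by (intro tendsto_intros lim c_lim)
  then have "((\<lambda>t. (?y t - 0) /\<^sub>R (t - t0)\<^sup>2) \<longlongrightarrow> (- 3 * k\<^sup>2, 0)) (at t0)"
    by (simp add: power_divide divide_inverse power2_eq_square power3_eq_cube mult_ac)
  then have "((\<lambda>t. (\<kappa> (?y t) - \<kappa> 0) /\<^sub>R (t - t0)\<^sup>2) \<longlongrightarrow> Q (- 3 * k\<^sup>2, 0)) (at t0)"
  proof (rule has_derivative_scaled_limit[OF Q(1), rotated 2])
    show "eventually (\<lambda>t. (t - t0)\<^sup>2 > 0) (at t0)"
      by (auto simp: eventually_at_filter)
    show "((\<lambda>t. (t - t0)\<^sup>2) \<longlongrightarrow> 0) (at t0)"
      by (auto intro!: tendsto_eq_intros)
  qed
  then have "((\<lambda>t. (g (\<gamma> t) - g (\<gamma> t0)) /\<^sub>R (t - t0)\<^sup>2) \<longlongrightarrow> Q (- 3 * k\<^sup>2, 0)) (at t0)"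
  proof (rule Lim_transform_eventually)
    have g0: "g (\<gamma> t0) = \<kappa> 0"
      using U(2,3,4) by (simp add: cusp_nf_def zero_prod_def)
    have g1: "g (\<gamma> t) = \<kappa> (?y t)" if "\<gamma> t \<in> U" for t
    proof -
      have "cusp_nf s (\<phi> (\<gamma> t)) = ?y t"
        unfolding c[OF that] by (simp add: cusp_nf_def power2_eq_square power3_eq_cube)
      then show ?thesis using U(4) that by simp
    qed
    have "eventually (\<lambda>t. \<gamma> t \<in> U) (at t0)"
      using ev by (simp add: eventually_nhds_conv_at)
    then show "eventually (\<lambda>t. (\<kappa> (?y t) - \<kappa> 0) /\<^sub>R (t - t0)\<^sup>2 = (g (\<gamma> t) - g (\<gamma> t0)) /\<^sub>R (t - t0)\<^sup>2) (at t0)"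
      by eventually_elim (simp only: g0 g1)
  qed
  moreover have "Q (- 3 * k\<^sup>2, 0) \<noteq> 0"
  proof
    assume "Q (- 3 * k\<^sup>2, 0) = 0"
    then have "(- 3 * k\<^sup>2, 0) = (0 :: R2)" using Q(2) Q.zero by metis
    then show False using k by (simp add: zero_prod_def)
  qed
  ultimately show ?thesis using that by blast
qed

section \<open>Isotropic planes at fold points\<close>

text \<open>The complex numbers have real dimension two, so a real functional on them has a
  nontrivial kernel.\<close>

lemma linear_complex_real_kernel:
  fixes l :: "complex \<Rightarrow> real"
  assumes "linear l"
  obtains \<zeta> where "\<zeta> \<noteq> 0" "l \<zeta> = 0"
proof (cases "l 1 = 0")
  case True
  then show ?thesis using that[of 1] by simp
next
  case False
  let ?\<zeta> = "l \<i> *\<^sub>R 1 - l 1 *\<^sub>R \<i>"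
  have "l ?\<zeta> = 0" using assms by (simp only: linear_diff linear_scale) simp
  moreover have "?\<zeta> \<noteq> 0" using False by (simp add: complex_eq_iff)
  ultimately show ?thesis using that by blast
qed

text \<open>At a fold the Hessian on the kernel is a nondegenerate form on a 3-space, so it has no
  isotropic plane.\<close>

lemma fold_point_not_flat:
  fixes g :: "'a::euclidean_space \<Rightarrow> 'b::euclidean_space" and L :: "complex \<Rightarrow> 'a"
  assumes nf: "has_normal_form_at g (fold_nf e) x"
    and L: "linear L" "inj L"
    and flat: "\<And>\<zeta>. ((\<lambda>t. (g (x + t *\<^sub>R L \<zeta>) - g x) /\<^sub>R t\<^sup>2) \<longlongrightarrow> 0) (at_right 0)"
  shows False
proof -
  obtain U \<phi> \<psi> D E P where U: "open U" "x \<in> U" "\<phi> x = 0" "\<psi> (g x) = 0" "\<forall>y\<in>U. \<psi> (g y) = fold_nf e (\<phi> y)"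
    and D: "(\<phi> has_derivative D) (at x)" "\<forall>h. E (D h) = h"
    and P: "(\<psi> has_derivative P) (at (g x))"
    by (rule normal_form_charts[OF nf]) (rule that; assumption)
  interpret D: bounded_linear D using D(1) by (rule has_derivative_bounded_linear)
  interpret P: bounded_linear P using P(1) by (rule has_derivative_bounded_linear)
  \<comment> \<open>Blowing up along the ray in direction \<open>L \<zeta>\<close> turns flatness of
    \<open>g\<close> into the vanishing of the linear component and of the quadratic form on
    \<open>D (L \<zeta>)\<close>.\<close>
  have iso: "fst (D (L \<zeta>)) = 0 \<and> (fst (snd (D (L \<zeta>))))\<^sup>2 + (fst (snd (snd (D (L \<zeta>)))))\<^sup>2
     + e * (snd (snd (snd (D (L \<zeta>)))))\<^sup>2 = 0" for \<zeta>
  proof -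
    let ?y = "\<lambda>t. x + t *\<^sub>R L \<zeta>" and ?v = "D (L \<zeta>)"
    have pos: "eventually (\<lambda>t::real. t > 0) (at_right 0)" by (simp add: eventually_at_right_less)
    have id: "((\<lambda>t::real. t) \<longlongrightarrow> 0) (at_right 0)" by (auto intro!: tendsto_eq_intros)
    have "(?y \<longlongrightarrow> x + 0 *\<^sub>R L \<zeta>) (at_right 0)" by (intro tendsto_intros)
    then have ev: "eventually (\<lambda>t. ?y t \<in> U) (at_right 0)"
      using U(1,2) by (simp add: topological_tendstoD)
    have "((\<lambda>t. (?y t - x) /\<^sub>R t) \<longlongrightarrow> L \<zeta>) (at_right 0)"
      by (rule Lim_transform_eventually[OF tendsto_const]) (use pos in \<open>auto elim!: eventually_mono\<close>)
    from has_derivative_scaled_limit[OF D(1) pos id this] U(3)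
    have lim1: "((\<lambda>t. \<phi> (?y t) /\<^sub>R t) \<longlongrightarrow> ?v) (at_right 0)" by simp
    have "eventually (\<lambda>t::real. t\<^sup>2 > 0) (at_right 0)" using pos by (auto elim!: eventually_mono)
    moreover have "((\<lambda>t::real. t\<^sup>2) \<longlongrightarrow> 0) (at_right 0)" by (auto intro!: tendsto_eq_intros)
    ultimately have "((\<lambda>t. (\<psi> (g (?y t)) - \<psi> (g x)) /\<^sub>R t\<^sup>2) \<longlongrightarrow> P 0) (at_right 0)"
      by (rule has_derivative_scaled_limit[OF P _ _ flat])
    then have "((\<lambda>t. \<psi> (g (?y t)) /\<^sub>R t\<^sup>2) \<longlongrightarrow> 0) (at_right 0)"
      using U(4) P.zero by simp
    then have lim2: "((\<lambda>t. fold_nf e (\<phi> (?y t)) /\<^sub>R t\<^sup>2) \<longlongrightarrow> 0) (at_right 0)"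
      by (rule Lim_transform_eventually) (use ev U(5) in \<open>auto elim!: eventually_mono\<close>)
    \<comment> \<open>The first component is linear, so one factor \<open>t\<close> is given back to
      reach the first-order quotient.\<close>
    have "((\<lambda>t. t *\<^sub>R fst (fold_nf e (\<phi> (?y t)) /\<^sub>R t\<^sup>2)) \<longlongrightarrow> 0 *\<^sub>R fst (0 :: R2)) (at_right 0)"
      by (intro tendsto_intros lim2)
    then have "((\<lambda>t. fst (\<phi> (?y t) /\<^sub>R t)) \<longlongrightarrow> 0) (at_right 0)"
      unfolding scale_zero_left by (rule Lim_transform_eventually)
         (use pos in \<open>auto elim!: eventually_mono simp: fold_nf_def case_prod_beta power2_eq_square\<close>)
    moreover have "((\<lambda>t. fst (\<phi> (?y t) /\<^sub>R t)) \<longlongrightarrow> fst ?v) (at_right 0)"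
      by (intro tendsto_intros lim1)
    ultimately have 1: "fst ?v = 0" using tendsto_unique trivial_limit_at_right_real by blast
    have "((\<lambda>t. snd (fold_nf e (\<phi> (?y t) /\<^sub>R t))) \<longlongrightarrow> snd (fold_nf e ?v)) (at_right 0)"
      unfolding fold_nf_def case_prod_beta snd_conv by (intro tendsto_intros lim1)
    moreover have "((\<lambda>t. snd (fold_nf e (\<phi> (?y t)) /\<^sub>R t\<^sup>2)) \<longlongrightarrow> snd (0 :: R2)) (at_right 0)"
      by (intro tendsto_intros lim2)
    then have "((\<lambda>t. snd (fold_nf e (\<phi> (?y t) /\<^sub>R t))) \<longlongrightarrow> 0) (at_right 0)"
      by (simp add: fold_nf_def case_prod_beta power_mult_distrib power_inverse algebra_simps)
    ultimately have "snd (fold_nf e ?v) = 0" using tendsto_unique trivial_limit_at_right_real by blast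
    then show ?thesis using 1 by (simp add: fold_nf_def case_prod_beta)
  qed
  \<comment> \<open>Some direction in the plane has last coordinate zero. There the form is a sum of
    two squares, so \<open>D (L \<zeta>)\<close> vanishes, against injectivity of \<open>D\<close>
    and \<open>L\<close>.\<close>
  have "linear (\<lambda>\<zeta>. snd (snd (snd (D (L \<zeta>)))))"
    using D.linear_axioms L(1) by (auto simp: linear_iff)
  then obtain \<zeta> where \<zeta>: "\<zeta> \<noteq> 0" "snd (snd (snd (D (L \<zeta>)))) = 0"
    by (rule linear_complex_real_kernel)
  then have "D (L \<zeta>) = 0" using iso[of \<zeta>] by (simp add: prod_eq_iff sum_power2_eq_zero_iff)
  then have "L \<zeta> = L 0" using D(2) D.zero linear_0[OF L(1)] by metis
  then show False using L(2) \<zeta>(1) by (simp add: inj_eq)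
qed

section \<open>Orders of vanishing along a curve\<close>

text \<open>Near \<open>t0\<close> the velocity is at most \<open>e / 2\<close> times the distance
  to \<open>t0\<close>; the mean value inequality turns this into a quadratic bound on the
  displacement.\<close>

lemma second_order_vanishing:
  fixes f :: "real \<Rightarrow> 'b::real_normed_vector"
  assumes f: "\<And>t. (f has_vector_derivative d t) (at t)" and d0: "d t0 = 0"
    and d: "(d has_vector_derivative 0) (at t0)"
  shows "((\<lambda>t. (f t - f t0) /\<^sub>R (t - t0)\<^sup>2) \<longlongrightarrow> 0) (at t0)"
proof (rule tendstoI)
  fix e :: real assume e: "e > 0"
  have "(d has_derivative (\<lambda>h. 0)) (at t0)" using d by (simp add: has_vector_derivative_def)
  then obtain r where r: "r > 0" "\<And>t. norm (t - t0) < r \<Longrightarrow> norm (d t) \<le> e / 2 * norm (t - t0)"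
    unfolding has_derivative_at_alt using e d0 by (metis diff_zero half_gt_zero)
  have "dist ((f t - f t0) /\<^sub>R (t - t0)\<^sup>2) 0 < e" if t: "t \<noteq> t0" "dist t t0 < r" for t
  proof -
    have "norm (f t - f t0) \<le> (e / 2 * norm (t - t0)) * norm (t - t0)"
    proof (rule differentiable_bound[OF convex_closed_segment])
      fix u assume u: "u \<in> closed_segment t0 t"
      show "(f has_derivative (\<lambda>h. h *\<^sub>R d u)) (at u within closed_segment t0 t)"
        using f[of u] has_derivative_at_withinI by (auto simp: has_vector_derivative_def)
      have ut: "norm (u - t0) \<le> norm (t - t0)" using u segment_bound1 by blast
      then have "norm (d u) \<le> e / 2 * norm (u - t0)" using r(2)[of u] t by (simp add: dist_norm)
      also have "\<dots> \<le> e / 2 * norm (t - t0)" using ut e by (intro mult_left_mono) auto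
      finally have "norm (d u) \<le> e / 2 * norm (t - t0)" .
      then show "onorm (\<lambda>h. h *\<^sub>R d u) \<le> e / 2 * norm (t - t0)"
        by (intro onorm_le) (metis mult.commute mult_left_mono norm_ge_zero norm_scaleR real_norm_def)
    qed auto
    also have "\<dots> = e / 2 * (t - t0)\<^sup>2" by (simp add: power2_eq_square)
    finally have "norm (f t - f t0) / (t - t0)\<^sup>2 \<le> e / 2" using t(1) by (simp add: field_simps)
    moreover have "dist ((f t - f t0) /\<^sub>R (t - t0)\<^sup>2) 0 = norm (f t - f t0) / (t - t0)\<^sup>2"
      by (simp add: divide_inverse_commute)
    ultimately show ?thesis using e by linarith
  qed
  then show "eventually (\<lambda>t. dist ((f t - f t0) /\<^sub>R (t - t0)\<^sup>2) 0 < e) (at t0)"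
    unfolding eventually_at using r(1) by blast
qed

text \<open>Multiplying the quadratic quotient by \<open>t - t0\<close> gives the difference
  quotient. The limit is taken from the right so that \<open>t - t0\<close> is a positive
  scale.\<close>

lemma quadratic_limit_imp_deriv_zero:
  fixes f :: "real \<Rightarrow> 'b::real_normed_vector"
  assumes f: "(f has_vector_derivative d) (at t0)"
    and lim: "((\<lambda>t. (f t - f t0) /\<^sub>R (t - t0)\<^sup>2) \<longlongrightarrow> C) (at t0)"
  shows "d = 0"
proof -
  have pos: "eventually (\<lambda>t. t - t0 > 0) (at_right t0)" by (simp add: eventually_at_right_less)
  have lim': "((\<lambda>t. (f t - f t0) /\<^sub>R (t - t0)\<^sup>2) \<longlongrightarrow> C) (at_right t0)"
    using lim by (simp add: filterlim_at_split)
  have "((\<lambda>t. (t - t0) *\<^sub>R ((f t - f t0) /\<^sub>R (t - t0)\<^sup>2)) \<longlongrightarrow> (t0 - t0) *\<^sub>R C) (at_right t0)"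
    by (intro tendsto_intros lim')
  then have "((\<lambda>t. (f t - f t0) /\<^sub>R (t - t0)) \<longlongrightarrow> 0) (at_right t0)"
    unfolding diff_self scale_zero_left
    by (rule Lim_transform_eventually) (use pos in \<open>auto elim!: eventually_mono simp: power2_eq_square\<close>)
  moreover have "((\<lambda>t. (f t - f t0) /\<^sub>R (t - t0)) \<longlongrightarrow> 1 *\<^sub>R d) (at_right t0)"
  proof (rule has_derivative_scaled_limit[OF f[unfolded has_vector_derivative_def] pos])
    show "((\<lambda>t. t - t0) \<longlongrightarrow> 0) (at_right t0)" by (auto intro!: tendsto_eq_intros)
    show "((\<lambda>t. (t - t0) /\<^sub>R (t - t0)) \<longlongrightarrow> 1) (at_right t0)"
      by (rule Lim_transform_eventually[OF tendsto_const]) (use pos in \<open>auto elim!: eventually_mono\<close>)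
  qed
  ultimately show ?thesis using tendsto_unique trivial_limit_at_right_real by fastforce
qed

section \<open>Critical curves of excellent maps\<close>

definition critical :: "('a::real_normed_vector \<Rightarrow> 'b::real_normed_vector) \<Rightarrow> 'a \<Rightarrow> bool" where
  "critical g x \<longleftrightarrow> (\<exists>G. (g has_derivative G) (at x) \<and> \<not> surj G)"

lemma excellent_critical_cases:
  assumes "excellent g" "critical g x" "x \<notin> cusps g"
  obtains e where "e \<noteq> 0" "has_normal_form_at g (fold_nf e) x"
proof -
  have "\<not> has_normal_form_at g regular_nf x"
    using assms(2) regular_point_surj unfolding critical_def by blast
  then have "has_normal_form_at g (fold_nf 1) x \<or> has_normal_form_at g (fold_nf (-1)) x"
    using assms(1,3) unfolding excellent_def cusps_def def_fold_nf_eq indef_fold_nf_eq by blast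
  then show ?thesis using that[of 1] that[of "-1"] by auto
qed

lemma cusps_critical:
  fixes g :: "'a::euclidean_space \<Rightarrow> 'b::euclidean_space"
  assumes "x \<in> cusps g" "(g has_derivative G) (at x)"
  shows "\<not> surj G"
  using assms cusp_point_not_surj unfolding cusps_def is_cusp_point_def by blast

text \<open>At a fold the image of the curve is immersed. At a cusp the quadratic limit forces zero
  velocity, and as this limit is nonzero, the velocity cannot vanish to second order.\<close>

lemma excellent_critical_curve:
  fixes g :: "complex \<times> complex \<Rightarrow> complex"
  assumes g: "excellent g" and crit: "\<And>t. critical g (\<gamma> t)"
    and \<gamma>: "(\<gamma> has_vector_derivative \<gamma>') (at t0)" "\<gamma>' \<noteq> 0"
    and d: "\<And>t. ((\<lambda>t. g (\<gamma> t)) has_vector_derivative d t) (at t)"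
  shows "\<gamma> t0 \<in> cusps g \<longleftrightarrow> d t0 = 0"
    and "\<gamma> t0 \<in> cusps g \<Longrightarrow> \<not> (d has_vector_derivative 0) (at t0)"
proof -
  note crit' = crit[unfolded critical_def]
  have cusp: "d t0 = 0 \<and> \<not> (d has_vector_derivative 0) (at t0)" if cu: "\<gamma> t0 \<in> cusps g"
  proof -
    obtain s where s: "s \<noteq> 0" and nf: "has_normal_form_at g (cusp_nf s) (\<gamma> t0)"
      using cu unfolding cusps_def is_cusp_point_def by (metis mem_Collect_eq neg_equal_0_iff_equal one_neq_zero)
    obtain C where C: "C \<noteq> 0" "((\<lambda>t. (g (\<gamma> t) - g (\<gamma> t0)) /\<^sub>R (t - t0)\<^sup>2) \<longlongrightarrow> C) (at t0)"
      using cusp_point_curve_quadratic[OF nf s \<gamma> crit'] .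
    have 0: "d t0 = 0" using quadratic_limit_imp_deriv_zero[OF d C(2)] .
    moreover have "\<not> (d has_vector_derivative 0) (at t0)"
      using second_order_vanishing[OF d 0] C tendsto_unique[OF trivial_limit_at] by blast
    ultimately show ?thesis by blast
  qed
  have fold: "d t0 \<noteq> 0" if nc: "\<gamma> t0 \<notin> cusps g"
  proof -
    obtain e where e: "e \<noteq> 0" and nf: "has_normal_form_at g (fold_nf e) (\<gamma> t0)"
      using excellent_critical_cases[OF g crit nc] .
    show ?thesis by (rule fold_point_curve_immersed[OF nf e \<gamma> crit' d])
  qed
  show "\<gamma> t0 \<in> cusps g \<longleftrightarrow> d t0 = 0" using cusp fold by blast
  show "\<gamma> t0 \<in> cusps g \<Longrightarrow> \<not> (d has_vector_derivative 0) (at t0)" using cusp by blast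
qed

section \<open>Zeros of a sum of two cosines\<close>

lemma cis_eq_cis_imp_eq:
  assumes "cis x = cis y" "\<bar>x - y\<bar> < 2 * pi"
  shows "x = y"
proof -
  obtain k :: int where k: "x = y + 2 * pi * k"
    using assms(1) sin_cos_eq_iff[of x y] by (auto simp: complex_eq_iff)
  then have "2 * pi * \<bar>real_of_int k\<bar> < 2 * pi * 1" using assms(2) by (simp add: abs_mult)
  then have "\<bar>real_of_int k\<bar> < 1" using mult_less_cancel_left_pos[of "2 * pi"] pi_gt_zero by simp
  then have "k = 0" by linarith
  then show ?thesis using k by simp
qed

lemma Re_cis_sum_has_derivative:
  "((\<lambda>\<theta>. Re (c * cis (k * \<theta>)) + Re (d * cis (l * \<theta>))) has_real_derivative
     - (k * Im (c * cis (k * \<theta>)) + l * Im (d * cis (l * \<theta>)))) (at \<theta>)"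
  by (auto intro!: derivative_eq_intros simp: algebra_simps)

text \<open>At the \<open>2k\<close> extrema of the dominating cosine the sum has alternating strict signs: a vanishing
  sum there would force the other cosine to be extremal as well, giving a double zero.\<close>

lemma card_circle_zeros_ge:
  fixes c d :: complex and k l :: nat
  assumes dom: "norm d \<le> norm c" and k: "k > 0"
    and simple: "\<And>\<theta>. Re (c * cis (real k * \<theta>)) + Re (d * cis (real l * \<theta>)) = 0 \<Longrightarrow>
      real k * Im (c * cis (real k * \<theta>)) + real l * Im (d * cis (real l * \<theta>)) \<noteq> 0"
    and fin: "finite {v. norm v = 1 \<and> Re (c * v ^ k) + Re (d * v ^ l) = 0}"
  shows "2 * k \<le> card {v. norm v = 1 \<and> Re (c * v ^ k) + Re (d * v ^ l) = 0}"
proof -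
  let ?Z = "{v. norm v = 1 \<and> Re (c * v ^ k) + Re (d * v ^ l) = 0}"
  define h where "h \<theta> = Re (c * cis (real k * \<theta>)) + Re (d * cis (real l * \<theta>))" for \<theta>
  \<comment> \<open>At \<open>\<theta> j\<close> the argument of
    \<open>c * cis (k * \<theta> j)\<close> is \<open>j * pi\<close>, so these are the extrema of
    the first cosine.\<close>
  define \<theta> where "\<theta> j = (real j * pi - Arg c) / k" for j :: nat
  have ext: "c * cis (real k * \<theta> j) = of_real ((-1) ^ j * norm c)" for j
  proof -
    have "c * cis (real k * \<theta> j) = rcis (cmod c) (Arg c) * cis (real j * pi - Arg c)"
      using k by (simp add: \<theta>_def rcis_cmod_Arg)
    also have "\<dots> = of_real (norm c) * cis (real j * pi)"
      by (simp add: rcis_def cis_mult mult.assoc)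
    also have "cis (real j * pi) = (-1) ^ j"
      using Complex.DeMoivre[of pi j] by simp
    finally show ?thesis by simp
  qed
  have sgn: "(-1) ^ j * h (\<theta> j) > 0" for j
  proof -
    define D where "D = d * cis (real l * \<theta> j)"
    have D: "norm D = norm d" by (simp add: D_def norm_mult)
    have h: "h (\<theta> j) = (-1) ^ j * norm c + Re D" by (simp add: h_def ext D_def)
    have one: "(-1::real) ^ j * (-1) ^ j = 1" by (simp flip: power_mult_distrib)
    have "(-1) ^ j * h (\<theta> j) = norm c + (-1) ^ j * Re D"
      unfolding h distrib_left mult.assoc[symmetric] one by simp
    moreover have "\<bar>(-1) ^ j * Re D\<bar> \<le> norm d"
      using abs_Re_le_cmod[of D] D by (simp add: abs_mult power_abs)
    moreover have "h (\<theta> j) \<noteq> 0"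
    proof
      assume 0: "h (\<theta> j) = 0"
      then have "\<bar>Re D\<bar> = norm c" using h by (metis abs_minus_cancel abs_mult abs_norm_cancel abs_1 abs_neg_one add_eq_0_iff mult_1 power_abs power_one)
      then have "Im D = 0"
        using dom D abs_Re_le_cmod[of D] cmod_power2[of D]
        by (metis add_cancel_left_right dual_order.antisym power2_abs power_eq_0_iff)
      then have "real k * Im (c * cis (real k * \<theta> j)) + real l * Im (d * cis (real l * \<theta> j)) = 0"
        unfolding ext D_def[symmetric] by simp
      then show False using simple 0 unfolding h_def by blast
    qed
    then have "(-1) ^ j * h (\<theta> j) \<noteq> 0" by simp
    ultimately show ?thesis using dom by linarith
  qed
  have less: "\<theta> j < \<theta> (Suc j)" for j
    using k by (simp add: \<theta>_def divide_strict_right_mono)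
  have cont: "continuous_on S h" for S
    unfolding h_def by (intro continuous_intros)
  have "\<exists>x. \<theta> j < x \<and> x < \<theta> (Suc j) \<and> h x = 0" for j
  proof -
    \<comment> \<open>The factor \<open>(-1) ^ j\<close> makes the function positive at the left end
      and negative at the right end for every \<open>j\<close>.\<close>
    have "\<exists>x\<ge>\<theta> j. x \<le> \<theta> (Suc j) \<and> (-1) ^ j * h x = 0"
    proof (rule IVT2')
      show "(-1) ^ j * h (\<theta> (Suc j)) \<le> 0" using sgn[of "Suc j"] by simp
      show "0 \<le> (-1) ^ j * h (\<theta> j)" using sgn[of j] by simp
    qed (use less[of j] cont in \<open>auto intro!: continuous_intros\<close>)
    then obtain x where x: "\<theta> j \<le> x" "x \<le> \<theta> (Suc j)" "h x = 0" by auto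
    moreover have "x \<noteq> \<theta> j" "x \<noteq> \<theta> (Suc j)" using x(3) sgn[of j] sgn[of "Suc j"] by auto
    ultimately show ?thesis by (intro exI[of _ x]) auto
  qed
  then obtain \<xi> where \<xi>: "\<And>j. \<theta> j < \<xi> j" "\<And>j. \<xi> j < \<theta> (Suc j)" "\<And>j. h (\<xi> j) = 0" by metis
  have mono: "\<theta> i \<le> \<theta> j" if "i \<le> j" for i j
    using that k by (simp add: \<theta>_def divide_right_mono)
  have \<xi>_less: "\<xi> i < \<xi> j" if "i < j" for i j
    using \<xi>(2)[of i] \<xi>(1)[of j] mono[of "Suc i" j] that by simp
  have inj: "inj_on (\<lambda>j. cis (\<xi> j)) {..<2 * k}"
  proof (rule inj_onI)
    fix i j assume ij: "i \<in> {..<2 * k}" "j \<in> {..<2 * k}" and eq: "cis (\<xi> i) = cis (\<xi> j)"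
    \<comment> \<open>The \<open>2 * k\<close> zeros lie strictly inside one period, so they give
      distinct points of the circle.\<close>
    have per: "\<theta> (2 * k) = \<theta> 0 + 2 * pi" using k by (simp add: \<theta>_def field_simps)
    have "\<theta> 0 < \<xi> r \<and> \<xi> r < \<theta> 0 + 2 * pi" if "r < 2 * k" for r
      using \<xi>(1)[of r] \<xi>(2)[of r] mono[of 0 r] mono[of "Suc r" "2 * k"] that per by simp
    then have "\<bar>\<xi> i - \<xi> j\<bar> < 2 * pi" using ij by (smt (verit) lessThan_iff)
    then have "\<xi> i = \<xi> j" using cis_eq_cis_imp_eq[OF eq] by simp
    then show "i = j" using \<xi>_less[of i j] \<xi>_less[of j i] by (metis less_irrefl linorder_neqE_nat)
  qed
  have "2 * k = card ((\<lambda>j. cis (\<xi> j)) ` {..<2 * k})" using inj by (simp add: card_image)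
  also have "\<dots> \<le> card ?Z"
    by (rule card_mono[OF fin]) (use \<xi>(3) in \<open>auto simp: h_def Complex.DeMoivre\<close>)
  finally show ?thesis .
qed

text \<open>On the unit circle \<open>cnj v\<close> is the inverse of \<open>v\<close>, so twice the
  sum times \<open>v ^ n\<close> is a polynomial in \<open>v\<close> of degree at most
  \<open>2 * n\<close>.\<close>

lemma card_circle_zeros_le:
  fixes c d :: complex and m n :: nat
  assumes mn: "m \<le> n"
    and simple: "\<And>\<theta>. Re (c * cis (real m * \<theta>)) + Re (d * cis (real n * \<theta>)) = 0 \<Longrightarrow>
      real m * Im (c * cis (real m * \<theta>)) + real n * Im (d * cis (real n * \<theta>)) \<noteq> 0"
  shows "finite {v. norm v = 1 \<and> Re (c * v ^ m) + Re (d * v ^ n) = 0}"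
    and "card {v. norm v = 1 \<and> Re (c * v ^ m) + Re (d * v ^ n) = 0} \<le> 2 * n"
proof -
  let ?Z = "{v. norm v = 1 \<and> Re (c * v ^ m) + Re (d * v ^ n) = 0}"
  define r where "r = monom c (n + m) + monom (cnj c) (n - m) + monom d (2 * n) + monom (cnj d) 0"
  have r: "poly r v = of_real (2 * (Re (c * v ^ m) + Re (d * v ^ n))) * v ^ n" if "norm v = 1" for v
  proof -
    have cv: "cnj v * v = 1" using that complex_norm_square[of v] by (simp add: mult.commute)
    have *: "of_real (2 * Re (e * v ^ j)) * v ^ n = e * v ^ (n + j) + cnj e * v ^ (n - j)" if "j \<le> n" for e j
    proof -
      have "cnj v ^ j * v ^ n = (cnj v * v) ^ j * v ^ (n - j)"
        using that by (simp add: power_mult_distrib mult.assoc flip: power_add)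
      then have "cnj v ^ j * v ^ n = v ^ (n - j)" using cv by simp
      moreover have "of_real (2 * Re (e * v ^ j)) = e * v ^ j + cnj e * cnj v ^ j"
        using complex_add_cnj[of "e * v ^ j"] by simp
      ultimately show ?thesis by (simp only: distrib_right mult.assoc power_add mult.commute[of "v ^ n"])
    qed
    have "poly r v = (c * v ^ (n + m) + cnj c * v ^ (n - m)) + (d * v ^ (n + n) + cnj d * v ^ (n - n))"
      by (simp add: r_def poly_monom mult_2)
    also have "\<dots> = of_real (2 * Re (c * v ^ m)) * v ^ n + of_real (2 * Re (d * v ^ n)) * v ^ n"
      by (simp only: *[OF mn] *[OF order_refl])
    finally show ?thesis by (simp only: distrib_left of_real_add distrib_right)
  qed
  \<comment> \<open>Otherwise the sum would vanish identically together with its derivative, against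
    simplicity of its zeros.\<close>
  have "r \<noteq> 0"
  proof
    assume "r = 0"
    have "Re (c * cis (real m * \<theta>)) + Re (d * cis (real n * \<theta>)) = 0" for \<theta>
    proof -
      have "of_real (2 * (Re (c * cis \<theta> ^ m) + Re (d * cis \<theta> ^ n))) * cis \<theta> ^ n = 0"
        using r[of "cis \<theta>"] \<open>r = 0\<close> by (simp only: poly_0 norm_cis)
      then have "2 * (Re (c * cis \<theta> ^ m) + Re (d * cis \<theta> ^ n)) = 0"
        by (simp only: mult_eq_0_iff of_real_eq_0_iff power_eq_0_iff cis_neq_zero) auto
      then show ?thesis by (simp only: Complex.DeMoivre) simp
    qed
    then show False
      using simple[of 0] DERIV_unique[OF Re_cis_sum_has_derivative[of c m d n 0]]
      by (metis (no_types, lifting) DERIV_const ext neg_equal_0_iff_equal)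
  qed
  have sub: "?Z \<subseteq> {v. poly r v = 0}"
  proof clarify
    fix v :: complex assume "norm v = 1" "Re (c * v ^ m) + Re (d * v ^ n) = 0"
    then show "poly r v = 0" by (simp only: r) simp
  qed
  have fin: "finite {v. poly r v = 0}" using poly_roots_finite[OF \<open>r \<noteq> 0\<close>] .
  show "finite ?Z" using finite_subset[OF sub fin] .
  have "card ?Z \<le> card {v. poly r v = 0}" using card_mono[OF fin sub] .
  also have "\<dots> \<le> degree r" using card_poly_roots_bound[OF \<open>r \<noteq> 0\<close>] .
  also have "\<dots> \<le> 2 * n"
    unfolding r_def using mn by (intro degree_add_le order.trans[OF degree_monom_le]) auto
  finally show "card ?Z \<le> 2 * n" .
qed

text \<open>The term of larger amplitude dictates the number of sign changes: at least
  \<open>2 * m\<close> zeros if it is the first, and \<open>2 * n \<ge> 2 * m\<close> if it is the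
  second.\<close>

lemma card_circle_zeros:
  fixes c d :: complex and m n :: nat
  assumes m: "0 < m" and mn: "m \<le> n"
    and simple: "\<And>\<theta>. Re (c * cis (real m * \<theta>)) + Re (d * cis (real n * \<theta>)) = 0 \<Longrightarrow>
      real m * Im (c * cis (real m * \<theta>)) + real n * Im (d * cis (real n * \<theta>)) \<noteq> 0"
  shows "2 * m \<le> card {v. norm v = 1 \<and> Re (c * v ^ m) + Re (d * v ^ n) = 0}" (is "_ \<le> card ?Z")
proof (cases "norm d \<le> norm c")
  case True
  show ?thesis
    using card_circle_zeros_ge[OF True m simple card_circle_zeros_le(1)[OF mn simple]] .
next
  case False
  have Z: "?Z = {v. norm v = 1 \<and> Re (d * v ^ n) + Re (c * v ^ m) = 0}" by (auto simp: add.commute)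
  have "2 * n \<le> card ?Z"
    unfolding Z
  proof (rule card_circle_zeros_ge)
    show "finite {v. norm v = 1 \<and> Re (d * v ^ n) + Re (c * v ^ m) = 0}"
      using card_circle_zeros_le(1)[OF mn simple] unfolding Z .
    show "real n * Im (d * cis (real n * \<theta>)) + real m * Im (c * cis (real m * \<theta>)) \<noteq> 0"
      if "Re (d * cis (real n * \<theta>)) + Re (c * cis (real m * \<theta>)) = 0" for \<theta>
    proof -
      have "Re (c * cis (real m * \<theta>)) + Re (d * cis (real n * \<theta>)) = 0" using that by linarith
      from simple[OF this] show ?thesis by linarith
    qed
  qed (use False m mn in auto)
  then show ?thesis using mn by linarith
qed

section \<open>The critical set\<close>

text \<open>The exponents of the paper are \<open>p = P + 1\<close> and \<open>q = Q + 1\<close>.\<close>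

definition mixed_map :: "nat \<Rightarrow> nat \<Rightarrow> complex \<Rightarrow> complex \<Rightarrow> complex \<times> complex \<Rightarrow> complex" where
  "mixed_map P Q a b = (\<lambda>(z, w). z ^ Suc P + w ^ Suc Q + a * cnj z + b * cnj w)"

lemma has_derivative_mixed_map:
  "(mixed_map P Q a b has_derivative (\<lambda>(h, k). of_nat (Suc P) * z ^ P * h + of_nat (Suc Q) * w ^ Q * k
      + a * cnj h + b * cnj k)) (at (z, w))"
proof -
  have pow: "((\<lambda>x :: complex. x ^ Suc n) has_derivative (\<lambda>h. of_nat (Suc n) * y ^ n * h)) (at y)" for n y
    using DERIV_power[OF DERIV_ident, of "Suc n" y] by (simp add: has_field_derivative_def)
  have 1: "((\<lambda>x. fst x ^ Suc P) has_derivative (\<lambda>h. of_nat (Suc P) * z ^ P * fst h)) (at (z, w))"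
    by (rule has_derivative_compose[where g = "\<lambda>x. x ^ Suc P"])
       (use pow[of P z] in \<open>auto intro!: derivative_intros\<close>)
  have 2: "((\<lambda>x. snd x ^ Suc Q) has_derivative (\<lambda>h. of_nat (Suc Q) * w ^ Q * snd h)) (at (z, w))"
    by (rule has_derivative_compose[where g = "\<lambda>x. x ^ Suc Q"])
       (use pow[of Q w] in \<open>auto intro!: derivative_intros\<close>)
  have "((\<lambda>x. fst x ^ Suc P + snd x ^ Suc Q + a * cnj (fst x) + b * cnj (snd x)) has_derivative
      (\<lambda>h. of_nat (Suc P) * z ^ P * fst h + of_nat (Suc Q) * w ^ Q * snd h + a * cnj (fst h) + b * cnj (snd h)))
      (at (z, w))"
    by (intro has_derivative_add 1 2 has_derivative_mult_right has_derivative_cnj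
        has_derivative_fst has_derivative_snd has_derivative_ident)
  then show ?thesis unfolding mixed_map_def case_prod_beta .
qed

text \<open>A proper image is orthogonal to some \<open>c \<noteq> 0\<close>, which means
  \<open>cnj c * \<alpha> + c * cnj a = 0\<close> and likewise for \<open>\<beta>\<close> and
  \<open>b\<close>; hence \<open>u = c / cnj c\<close>. Conversely a square root \<open>s\<close> of
  \<open>u\<close> is orthogonal to the image.\<close>

lemma not_surj_iff_unimodular:
  fixes \<alpha> \<beta> a b :: complex
  shows "\<not> surj (\<lambda>(h, k). \<alpha> * h + \<beta> * k + a * cnj h + b * cnj k) \<longleftrightarrow>
    (\<exists>u. norm u = 1 \<and> \<alpha> = - cnj a * u \<and> \<beta> = - cnj b * u)" (is "\<not> surj ?L \<longleftrightarrow> _")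
proof
  assume ns: "\<not> surj ?L"
  have "linear ?L"
    by (auto simp: linear_iff algebra_simps scaleR_conv_of_real)
  then have span: "span (range ?L) = range ?L"
    using linear_subspace_image[OF _ subspace_UNIV] span_eq_iff by blast
  then have "span (range ?L) \<noteq> UNIV" using ns by (simp only: span not_False_eq_True)
  from span_not_UNIV_orthogonal[OF this] obtain c where c: "c \<noteq> 0" "\<forall>y \<in> range ?L. c \<bullet> y = 0"
    unfolding span by blast
  have z: "y = 0" if "\<And>h. Re (y * h) = 0" for y :: complex
    using that[of "cnj y"] by (simp add: complex_eq_iff sum_squares_eq_zero_iff)
  have "Re ((cnj c * \<alpha> + c * cnj a) * h) = 0" for h
    using bspec[OF c(2) rangeI[of _ "(h, 0)"]] by (simp add: inner_complex_def algebra_simps)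
  then have 1: "cnj c * \<alpha> + c * cnj a = 0" using z by blast
  have "Re ((cnj c * \<beta> + c * cnj b) * h) = 0" for h
    using bspec[OF c(2) rangeI[of _ "(0, h)"]] by (simp add: inner_complex_def algebra_simps)
  then have 2: "cnj c * \<beta> + c * cnj b = 0" using z by blast
  show "\<exists>u. norm u = 1 \<and> \<alpha> = - cnj a * u \<and> \<beta> = - cnj b * u"
    using 1 2 c(1) by (intro exI[of _ "c / cnj c"]) (auto simp: norm_divide field_simps eq_neg_iff_add_eq_0)
next
  assume "\<exists>u. norm u = 1 \<and> \<alpha> = - cnj a * u \<and> \<beta> = - cnj b * u"
  then obtain u where u: "norm u = 1" "\<alpha> = - cnj a * u" "\<beta> = - cnj b * u" by blast
  define s where "s = csqrt u"
  have s: "s\<^sup>2 = u" by (simp add: s_def)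
  have "norm s = 1" using u(1) s norm_power[of s 2] by (simp add: power2_eq_1_iff) (smt (verit) norm_ge_zero)
  then have ss: "cnj s * s = 1" using complex_norm_square[of s] by (simp add: mult.commute)
  have *: "Re (cnj s * (- cnj e * u * h + e * cnj h)) = 0" for e h
  proof -
    have "cnj s * (- cnj e * u * h + e * cnj h) = - (cnj s * s) * (cnj e * s * h) + cnj (cnj e * s * h)"
      unfolding s[symmetric] by (simp add: algebra_simps power2_eq_square)
    moreover have "Re (- 1 * x + cnj x) = 0" for x by simp
    ultimately show ?thesis by (simp only: ss)
  qed
  have "s \<notin> range ?L"
  proof
    assume "s \<in> range ?L"
    then obtain x where x: "s = ?L x" by (rule rangeE)
    obtain h k where hk: "x = (h, k)" by (cases x)
    have "s = (- cnj a * u * h + a * cnj h) + (- cnj b * u * k + b * cnj k)"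
      using x unfolding hk u by (simp only: prod.case add_ac)
    then have "Re (cnj s * s) = Re (cnj s * (- cnj a * u * h + a * cnj h)) + Re (cnj s * (- cnj b * u * k + b * cnj k))"
      by (metis distrib_left plus_complex.sel(1))
    then show False using * ss by simp
  qed
  then show "\<not> surj ?L" by blast
qed

lemma critical_mixed_map_iff:
  "critical (mixed_map P Q a b) (z, w) \<longleftrightarrow>
    (\<exists>u. norm u = 1 \<and> of_nat (Suc P) * z ^ P = - cnj a * u \<and> of_nat (Suc Q) * w ^ Q = - cnj b * u)"
  unfolding critical_def not_surj_iff_unimodular[symmetric]
  using has_derivative_mixed_map has_derivative_unique by blast

text \<open>With \<open>z\<close>, \<open>w\<close> ranging over these roots and \<open>v\<close> over the unit circle, \<open>crit_curve\<close> covers the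
  critical set, the unimodular factor in \<open>critical_mixed_map_iff\<close> being \<open>v\<close> to the power \<open>2PQ\<close>; the
  exponents are doubled so that this factor has the square root \<open>v\<close> to the power \<open>PQ\<close>.\<close>

definition base_roots :: "nat \<Rightarrow> complex \<Rightarrow> complex set" where
  "base_roots P a = {z. of_nat (Suc P) * z ^ P = - cnj a}"

definition crit_curve :: "nat \<Rightarrow> nat \<Rightarrow> complex \<Rightarrow> complex \<Rightarrow> complex \<Rightarrow> complex \<times> complex" where
  "crit_curve P Q z w v = (z * v ^ (2 * Q), w * v ^ (2 * P))"

lemma critical_crit_curve:
  assumes "z \<in> base_roots P a" "w \<in> base_roots Q b" "norm v = 1"
  shows "critical (mixed_map P Q a b) (crit_curve P Q z w v)"
  unfolding crit_curve_def critical_mixed_map_iff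
  by (rule exI[of _ "v ^ (2 * P * Q)"])
     (use assms in \<open>auto simp: base_roots_def norm_power power_mult_distrib mult_ac simp flip: power_mult mult.assoc\<close>)

lemma has_vector_derivative_cis_power:
  "((\<lambda>\<theta>. cis \<theta> ^ k) has_vector_derivative of_nat k * \<i> * cis \<theta> ^ k) (at \<theta>)"
  unfolding Complex.DeMoivre has_vector_derivative_def
  by (auto intro!: derivative_eq_intros simp: fun_eq_iff scaleR_conv_of_real)

lemma has_vector_derivative_crit_curve:
  "((\<lambda>\<theta>. crit_curve P Q z w (cis \<theta>)) has_vector_derivative
    (z * (of_nat (2 * Q) * \<i> * cis \<theta> ^ (2 * Q)), w * (of_nat (2 * P) * \<i> * cis \<theta> ^ (2 * P)))) (at \<theta>)"
  unfolding crit_curve_def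
  by (intro has_vector_derivative_Pair has_vector_derivative_mult_right has_vector_derivative_cis_power)

text \<open>With \<open>s = v ^ (P * Q)\<close> the unimodular factor is \<open>s^2\<close>.
  Extracting \<open>s\<close> from the velocity leaves differences of conjugate terms, which are
  purely imaginary up to a common factor. The frequencies arise as \<open>P * Q + 2 * Q\<close> and
  \<open>P * Q + 2 * P\<close>.\<close>

lemma mixed_map_crit_curve_derivative:
  assumes z: "z \<in> base_roots P a" and w: "w \<in> base_roots Q b"
  shows "((\<lambda>\<theta>. mixed_map P Q a b (crit_curve P Q z w (cis \<theta>))) has_vector_derivative
      of_real (Re (of_nat Q * cnj a * z * cis (real ((P + 2) * Q) * \<theta>)) + Re (of_nat P * cnj b * w * cis (real (P * (Q + 2)) * \<theta>)))
        * (- 4 * \<i> * cis (real (P * Q) * \<theta>))) (at \<theta>)"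
proof -
  define v where "v = cis \<theta>"
  define s where "s = v ^ (P * Q)"
  define Z where "Z = z * v ^ (2 * Q)"
  define W where "W = w * v ^ (2 * P)"
  have "norm s = 1" by (simp add: s_def v_def norm_power)
  then have ss: "s * cnj s = 1" using complex_norm_square[of s] by simp
  have pt: "crit_curve P Q z w (cis \<theta>) = (Z, W)" by (simp add: crit_curve_def Z_def W_def v_def)
  have \<gamma>: "((\<lambda>\<theta>. crit_curve P Q z w (cis \<theta>)) has_vector_derivative
      (of_nat (2 * Q) * \<i> * Z, of_nat (2 * P) * \<i> * W)) (at \<theta>)"
    using has_vector_derivative_crit_curve[of P Q z w \<theta>] by (simp only: Z_def W_def v_def mult_ac)
  have der: "((\<lambda>\<theta>. mixed_map P Q a b (crit_curve P Q z w (cis \<theta>))) has_vector_derivative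
      of_nat (Suc P) * Z ^ P * (of_nat (2 * Q) * \<i> * Z) + of_nat (Suc Q) * W ^ Q * (of_nat (2 * P) * \<i> * W)
       + a * cnj (of_nat (2 * Q) * \<i> * Z) + b * cnj (of_nat (2 * P) * \<i> * W)) (at \<theta>)"
    using vector_derivative_diff_chain_within[OF \<gamma>
        has_derivative_at_withinI[OF has_derivative_mixed_map[of P Q a b Z W, folded pt]]]
    by (simp only: o_def prod.case)
  have ZW: "of_nat (Suc P) * Z ^ P = - cnj a * s\<^sup>2" "of_nat (Suc Q) * W ^ Q = - cnj b * s\<^sup>2"
    using z w by (simp_all add: Z_def W_def s_def base_roots_def power_mult_distrib mult_ac
        flip: power_mult mult.assoc)
  have two: "2 * of_real (Re X) = X + cnj X" for X by (simp add: complex_add_cnj)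
  \<comment> \<open>Since \<open>s * cnj s = 1\<close>, the two summands are
    \<open>- \<i> * s\<close> times the conjugate pair belonging to
    \<open>cnj c * s * Y\<close>.\<close>
  have X: "- cnj c * s\<^sup>2 * (\<i> * Y) + c * cnj (\<i> * Y) = of_real (Re (cnj c * s * Y)) * (- 2 * \<i> * s)" for c Y
  proof -
    have "of_real (Re (cnj c * s * Y)) * (- 2 * \<i> * s) = (2 * of_real (Re (cnj c * s * Y))) * (- \<i> * s)" by simp
    also have "\<dots> = - \<i> * (cnj c * s\<^sup>2 * Y) - \<i> * c * cnj Y * (s * cnj s)"
      unfolding two by (simp add: algebra_simps power2_eq_square)
    finally show ?thesis unfolding ss by (simp add: algebra_simps)
  qed
  have "- cnj a * s\<^sup>2 * (of_nat (2 * Q) * \<i> * Z) + - cnj b * s\<^sup>2 * (of_nat (2 * P) * \<i> * W)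
       + a * cnj (of_nat (2 * Q) * \<i> * Z) + b * cnj (of_nat (2 * P) * \<i> * W)
     = of_nat (2 * Q) * (- cnj a * s\<^sup>2 * (\<i> * Z) + a * cnj (\<i> * Z)) + of_nat (2 * P) * (- cnj b * s\<^sup>2 * (\<i> * W) + b * cnj (\<i> * W))"
    by (simp add: algebra_simps)
  also have "\<dots> = of_real (real Q * Re (cnj a * s * Z) + real P * Re (cnj b * s * W)) * (- 4 * \<i> * s)"
    unfolding X by (simp add: algebra_simps)
  also have "real Q * Re (cnj a * s * Z) = Re (of_nat Q * cnj a * z * cis (real ((P + 2) * Q) * \<theta>))"
  proof -
    have "s * v ^ (2 * Q) = v ^ ((P + 2) * Q)" by (simp only: s_def distrib_right flip: power_add)
    then have "of_nat Q * cnj a * z * v ^ ((P + 2) * Q) = of_real (real Q) * (cnj a * s * Z)"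
      by (metis (no_types, lifting) Z_def mult.assoc mult.left_commute of_real_of_nat_eq)
    then show ?thesis unfolding v_def Complex.DeMoivre by (metis scaleR_complex.sel(1) scaleR_conv_of_real)
  qed
  also have "real P * Re (cnj b * s * W) = Re (of_nat P * cnj b * w * cis (real (P * (Q + 2)) * \<theta>))"
  proof -
    have "s * v ^ (2 * P) = v ^ (P * (Q + 2))"
      by (simp only: s_def distrib_left mult.commute[of 2 P] flip: power_add)
    then have "of_nat P * cnj b * w * v ^ (P * (Q + 2)) = of_real (real P) * (cnj b * s * W)"
      by (metis (no_types, lifting) W_def mult.assoc mult.left_commute of_real_of_nat_eq)
    then show ?thesis unfolding v_def Complex.DeMoivre by (metis scaleR_complex.sel(1) scaleR_conv_of_real)
  qed
  finally show ?thesis using der by (simp only: ZW s_def v_def Complex.DeMoivre)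
qed

section \<open>Counting cusps\<close>

lemma card_eq_mult_card_image:
  assumes "finite S" and fib: "\<And>x. x \<in> f ` S \<Longrightarrow> card {t \<in> S. f t = x} = k"
  shows "card S = card (f ` S) * k"
proof -
  have "card S = (\<Sum>x\<in>f ` S. card {t \<in> S. f t = x})"
    using sum.image_gen[OF assms(1), of "\<lambda>_. 1 :: nat" f] by simp
  then show ?thesis using fib by simp
qed

context
  fixes P Q :: nat and a b :: complex
  assumes exc: "excellent (mixed_map P Q a b)" and P: "P > 0" and Q: "Q > 0" and ab: "a \<noteq> 0 \<or> b \<noteq> 0"
begin

text \<open>As \<open>a\<close> and \<open>b\<close> do not both vanish, at least one of the base
  roots is nonzero, and its component moves.\<close>

lemma crit_curve_velocity:
  assumes z: "z \<in> base_roots P a" and w: "w \<in> base_roots Q b"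
  obtains \<gamma>' where "((\<lambda>\<theta>. crit_curve P Q z w (cis \<theta>)) has_vector_derivative \<gamma>') (at \<theta>)" "\<gamma>' \<noteq> 0"
proof -
  have "z \<noteq> 0 \<or> w \<noteq> 0" using z w ab P Q by (auto simp: base_roots_def zero_power)
  then show ?thesis using P Q by (intro that[OF has_vector_derivative_crit_curve]) (auto simp: zero_prod_def)
qed

text \<open>Cusps are the points where the velocity of the image vanishes, and this velocity is the
  displayed sum times a factor without zeros.\<close>

lemma crit_curve_cusp_iff:
  assumes z: "z \<in> base_roots P a" and w: "w \<in> base_roots Q b" and v: "norm v = 1"
  shows "crit_curve P Q z w v \<in> cusps (mixed_map P Q a b) \<longleftrightarrow>
    Re (of_nat Q * cnj a * z * v ^ ((P + 2) * Q)) + Re (of_nat P * cnj b * w * v ^ (P * (Q + 2))) = 0"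
proof -
  obtain \<theta> where \<theta>: "v = cis \<theta>" using v by (metis rcis_cmod_Arg rcis_def mult_1 of_real_1)
  obtain \<gamma>' where \<gamma>: "((\<lambda>\<theta>. crit_curve P Q z w (cis \<theta>)) has_vector_derivative \<gamma>') (at \<theta>)" "\<gamma>' \<noteq> 0"
    using crit_curve_velocity[OF z w] .
  show ?thesis
    unfolding \<theta> Complex.DeMoivre
    using excellent_critical_curve(1)[OF exc critical_crit_curve[OF z w norm_cis] \<gamma> mixed_map_crit_curve_derivative[OF z w]]
    by (simp only: mult_eq_0_iff of_real_eq_0_iff cis_neq_zero) simp
qed

text \<open>At a double zero the product rule would give the image velocity a zero derivative, which
  is impossible at a cusp. This supplies the simplicity hypothesis of the zero counts.\<close>

lemma crit_curve_cusp_simple: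
  assumes z: "z \<in> base_roots P a" and w: "w \<in> base_roots Q b"
    and zero: "Re (of_nat Q * cnj a * z * cis (real ((P + 2) * Q) * \<theta>))
      + Re (of_nat P * cnj b * w * cis (real (P * (Q + 2)) * \<theta>)) = 0"
  shows "real ((P + 2) * Q) * Im (of_nat Q * cnj a * z * cis (real ((P + 2) * Q) * \<theta>))
      + real (P * (Q + 2)) * Im (of_nat P * cnj b * w * cis (real (P * (Q + 2)) * \<theta>)) \<noteq> 0"
proof
  assume flat: "real ((P + 2) * Q) * Im (of_nat Q * cnj a * z * cis (real ((P + 2) * Q) * \<theta>))
      + real (P * (Q + 2)) * Im (of_nat P * cnj b * w * cis (real (P * (Q + 2)) * \<theta>)) = 0"
  define h where "h \<theta> = Re (of_nat Q * cnj a * z * cis (real ((P + 2) * Q) * \<theta>))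
      + Re (of_nat P * cnj b * w * cis (real (P * (Q + 2)) * \<theta>))" for \<theta>
  have "(h has_real_derivative 0) (at \<theta>)"
    using Re_cis_sum_has_derivative[of "of_nat Q * cnj a * z" "real ((P + 2) * Q)" "of_nat P * cnj b * w" "real (P * (Q + 2))" \<theta>]
    unfolding flat h_def[symmetric] by simp
  then have "((\<lambda>\<theta>. complex_of_real (h \<theta>)) has_vector_derivative of_real 0) (at \<theta>)"
    by (intro has_vector_derivative_of_real) (simp add: has_real_derivative_iff_has_vector_derivative)
  moreover have "((\<lambda>\<theta>. - 4 * \<i> * cis (real (P * Q) * \<theta>)) has_vector_derivative - 4 * \<i> * (of_nat (P * Q) * \<i> * cis \<theta> ^ (P * Q))) (at \<theta>)"
    unfolding Complex.DeMoivre[symmetric]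
    by (intro has_vector_derivative_mult_right has_vector_derivative_cis_power)
  ultimately have "((\<lambda>\<theta>. of_real (h \<theta>) * (- 4 * \<i> * cis (real (P * Q) * \<theta>))) has_vector_derivative 0) (at \<theta>)"
    using has_vector_derivative_mult[of "\<lambda>\<theta>. complex_of_real (h \<theta>)" "of_real 0" \<theta> UNIV "\<lambda>\<theta>. - 4 * \<i> * cis (real (P * Q) * \<theta>)"]
      zero unfolding h_def[symmetric] by simp
  moreover obtain \<gamma>' where \<gamma>: "((\<lambda>\<theta>. crit_curve P Q z w (cis \<theta>)) has_vector_derivative \<gamma>') (at \<theta>)" "\<gamma>' \<noteq> 0"
    using crit_curve_velocity[OF z w] .
  moreover have "crit_curve P Q z w (cis \<theta>) \<in> cusps (mixed_map P Q a b)"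
    using crit_curve_cusp_iff[OF z w norm_cis] zero by (simp only: Complex.DeMoivre)
  ultimately show False
    using excellent_critical_curve(2)[OF exc critical_crit_curve[OF z w norm_cis] \<gamma> mixed_map_crit_curve_derivative[OF z w]]
    unfolding h_def[symmetric] by blast
qed

definition cusp_params :: "complex \<times> complex \<Rightarrow> complex set" where
  "cusp_params = (\<lambda>(z, w). {v. norm v = 1 \<and>
    Re (of_nat Q * cnj a * z * v ^ ((P + 2) * Q)) + Re (of_nat P * cnj b * w * v ^ (P * (Q + 2))) = 0})"

text \<open>A critical point determines its unimodular factor \<open>u\<close>, and a triple above
  it is determined by \<open>v\<close> with \<open>v ^ (2 * P * Q) = u\<close>; there are
  \<open>2 * P * Q\<close> such roots.\<close>

lemma card_cusp_fibre:
  assumes x: "x \<in> cusps (mixed_map P Q a b)"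
  shows "card {t \<in> Sigma (base_roots P a \<times> base_roots Q b) cusp_params.
    (\<lambda>((z, w), v). crit_curve P Q z w v) t = x} = 2 * P * Q" (is "card ?T = _")
proof -
  obtain x1 x2 where x12: "x = (x1, x2)" by (cases x)
  have "critical (mixed_map P Q a b) (x1, x2)"
    using cusps_critical[OF x[unfolded x12] has_derivative_mixed_map] has_derivative_mixed_map
    unfolding critical_def by blast
  then obtain u where u: "norm u = 1" "of_nat (Suc P) * x1 ^ P = - cnj a * u" "of_nat (Suc Q) * x2 ^ Q = - cnj b * u"
    unfolding critical_mixed_map_iff by blast
  have u0: "u \<noteq> 0" using u(1) by auto
  let ?f = "\<lambda>v. ((x1 / v ^ (2 * Q), x2 / v ^ (2 * P)), v)"
  have "?T = ?f ` {v. v ^ (2 * P * Q) = u}"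
  proof (intro set_eqI iffI)
    fix t assume "t \<in> ?T"
    then obtain z w v where t: "t = ((z, w), v)" "z \<in> base_roots P a" "w \<in> base_roots Q b"
      "norm v = 1" "x1 = z * v ^ (2 * Q)" "x2 = w * v ^ (2 * P)"
      by (auto simp: cusp_params_def crit_curve_def x12)
    have v0: "v \<noteq> 0" using t(4) by auto
    have "of_nat (Suc P) * x1 ^ P = (of_nat (Suc P) * z ^ P) * v ^ (2 * P * Q)"
      unfolding t(5) by (simp add: power_mult_distrib mult_ac flip: power_mult)
    then have 1: "- cnj a * u = - cnj a * v ^ (2 * P * Q)"
      using u(2) t(2) unfolding base_roots_def mem_Collect_eq by (simp only:)
    have "of_nat (Suc Q) * x2 ^ Q = (of_nat (Suc Q) * w ^ Q) * v ^ (2 * P * Q)"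
      unfolding t(6) by (simp add: power_mult_distrib mult_ac flip: power_mult)
    then have 2: "- cnj b * u = - cnj b * v ^ (2 * P * Q)"
      using u(3) t(3) unfolding base_roots_def mem_Collect_eq by (simp only:)
    \<comment> \<open>Whichever of \<open>a\<close> and \<open>b\<close> is nonzero allows
      cancellation.\<close>
    have "v ^ (2 * P * Q) = u" using 1 2 ab by auto
    then show "t \<in> ?f ` {v. v ^ (2 * P * Q) = u}" using t v0 by (intro image_eqI[of _ _ v]) auto
  next
    fix t assume "t \<in> ?f ` {v. v ^ (2 * P * Q) = u}"
    then obtain v where v: "v ^ (2 * P * Q) = u" "t = ?f v" by auto
    have nv: "norm v = 1"
    proof -
      have "norm v ^ (2 * P * Q) = 1" using v(1) u(1) by (simp flip: norm_power)
      then show ?thesis using P Q power_eq_1_iff[of "norm v" "2 * P * Q"] by simp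
    qed
    then have v0: "v \<noteq> 0" by auto
    have "of_nat (Suc P) * (x1 / v ^ (2 * Q)) ^ P = (of_nat (Suc P) * x1 ^ P) / v ^ (2 * P * Q)"
      by (simp add: power_divide mult_ac flip: power_mult)
    then have z: "x1 / v ^ (2 * Q) \<in> base_roots P a"
      unfolding u(2) v(1) using u0 by (simp add: base_roots_def)
    have "of_nat (Suc Q) * (x2 / v ^ (2 * P)) ^ Q = (of_nat (Suc Q) * x2 ^ Q) / v ^ (2 * P * Q)"
      by (simp add: power_divide mult_ac flip: power_mult)
    then have w: "x2 / v ^ (2 * P) \<in> base_roots Q b"
      unfolding u(3) v(1) using u0 by (simp add: base_roots_def)
    have pt: "crit_curve P Q (x1 / v ^ (2 * Q)) (x2 / v ^ (2 * P)) v = x"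
      using v0 by (simp add: crit_curve_def x12)
    have "v \<in> cusp_params (x1 / v ^ (2 * Q), x2 / v ^ (2 * P))"
      unfolding cusp_params_def prod.case mem_Collect_eq
      using crit_curve_cusp_iff[OF z w nv] x unfolding pt using nv by blast
    then show "t \<in> ?T" using z w pt v(2) by simp
  qed
  then have "card ?T = card {v. v ^ (2 * P * Q) = u}"
    by (simp add: card_image inj_on_def)
  also have "\<dots> = 2 * P * Q" using card_nth_roots[OF u0] P Q by simp
  finally show ?thesis .
qed

text \<open>Double counting of triples \<open>((z, w), v)\<close>: each of the \<open>P * Q\<close>
  pairs of roots carries between \<open>2 * (P + 2) * Q\<close> and \<open>2 * P * (Q + 2)\<close>
  parameters, and every cusp is hit \<open>2 * P * Q\<close> times.\<close>

lemma card_cusps_mixed_map: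
  assumes PQ: "Q \<le> P" and ca: "card (base_roots P a) = P" and cb: "card (base_roots Q b) = Q"
  shows "finite (cusps (mixed_map P Q a b))" "(P + 2) * Q \<le> card (cusps (mixed_map P Q a b))"
    "card (cusps (mixed_map P Q a b)) \<le> P * (Q + 2)"
proof -
  let ?R = "base_roots P a \<times> base_roots Q b"
  let ?S = "Sigma ?R cusp_params" and ?f = "\<lambda>((z, w), v). crit_curve P Q z w v"
  have finR: "finite ?R" using ca cb P Q by (intro finite_cartesian_product) (auto intro: card_ge_0_finite)
  have mn: "(P + 2) * Q \<le> P * (Q + 2)" "0 < (P + 2) * Q" using PQ Q by (auto simp: algebra_simps)
  have params: "finite (cusp_params r) \<and> 2 * ((P + 2) * Q) \<le> card (cusp_params r) \<and> card (cusp_params r) \<le> 2 * (P * (Q + 2))"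
    if r: "r \<in> ?R" for r
  proof -
    obtain z w where zw: "r = (z, w)" by (cases r)
    then have z: "z \<in> base_roots P a" and w: "w \<in> base_roots Q b" using r by auto
    note simple = crit_curve_cusp_simple[OF z w]
    show ?thesis
      unfolding zw cusp_params_def prod.case
      using card_circle_zeros_le[OF mn(1) simple] card_circle_zeros[OF mn(2,1) simple] by blast
  qed
  have finS: "finite ?S" using finR params by blast
  have img: "?f ` ?S = cusps (mixed_map P Q a b)"
  proof (intro equalityI subsetI)
    fix x assume "x \<in> ?f ` ?S"
    then show "x \<in> cusps (mixed_map P Q a b)"
      using crit_curve_cusp_iff by (auto simp: cusp_params_def)
  next
    fix x assume "x \<in> cusps (mixed_map P Q a b)"
    \<comment> \<open>Positive fibre size shows that every cusp is reached by one of the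
      curves.\<close>
    then have "card {t \<in> ?S. ?f t = x} > 0" using card_cusp_fibre P Q by simp
    then have "{t \<in> ?S. ?f t = x} \<noteq> {}"
      by (intro notI) (simp only: card.empty less_irrefl)
    then show "x \<in> ?f ` ?S" by blast
  qed
  have cardS: "card ?S = card (cusps (mixed_map P Q a b)) * (2 * P * Q)"
    using card_eq_mult_card_image[OF finS, of ?f] card_cusp_fibre unfolding img by blast
  have sum: "card ?S = (\<Sum>r\<in>?R. card (cusp_params r))"
    using card_SigmaI[OF finR] params by blast
  have cR: "card ?R = P * Q" using ca cb by (simp add: card_cartesian_product)
  have "(P + 2) * Q * (2 * P * Q) \<le> card (cusps (mixed_map P Q a b)) * (2 * P * Q)"
    using sum_bounded_below[of ?R "2 * ((P + 2) * Q)" "\<lambda>r. card (cusp_params r)"] params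
    unfolding cardS[symmetric] sum cR by (simp add: mult_ac)
  then show "(P + 2) * Q \<le> card (cusps (mixed_map P Q a b))" using P Q by simp
  have "card (cusps (mixed_map P Q a b)) * (2 * P * Q) \<le> P * (Q + 2) * (2 * P * Q)"
    using sum_bounded_above[of ?R "\<lambda>r. card (cusp_params r)" "2 * (P * (Q + 2))"] params
    unfolding cardS[symmetric] sum cR by (simp add: mult_ac)
  then show "card (cusps (mixed_map P Q a b)) \<le> P * (Q + 2)" using P Q by simp
  show "finite (cusps (mixed_map P Q a b))" using finS img by (metis finite_imageI)
qed

end

section \<open>Vanishing coefficients and the final count\<close>

lemma card_base_roots:
  assumes "a \<noteq> 0" "P > 0"
  shows "card (base_roots P a) = P"
proof -
  have "base_roots P a = {z. z ^ P = - cnj a / of_nat (Suc P)}"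
    unfolding base_roots_def by (rule Collect_cong) (simp add: field_simps del: of_nat_Suc)
  then show ?thesis using card_nth_roots[of "- cnj a / of_nat (Suc P)" P] assms by (simp del: of_nat_Suc)
qed

text \<open>The increment along the plane is homogeneous of degree \<open>k + 1 \<ge> 3\<close>, so
  its quotient by \<open>t^2\<close> tends to zero, which no fold allows.\<close>

lemma excellent_not_flat:
  assumes exc: "excellent g" and crit: "critical g x" and nc: "x \<notin> cusps g"
    and L: "linear L" "inj L"
    and flat: "\<And>\<zeta> t. g (x + t *\<^sub>R L \<zeta>) - g x = (of_real t * \<zeta>) ^ Suc k" and k: "k \<ge> 2"
  shows False
proof -
  obtain e where nf: "has_normal_form_at g (fold_nf e) x"
    using excellent_critical_cases[OF exc crit nc] .
  show False
  proof (rule fold_point_not_flat[OF nf L])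
    fix \<zeta> :: complex
    have "((\<lambda>t. of_real (t ^ (k - 1)) * \<zeta> ^ Suc k) \<longlongrightarrow> of_real (0 ^ (k - 1)) * \<zeta> ^ Suc k) (at_right 0)"
      by (intro tendsto_intros)
    then have "((\<lambda>t. of_real (t ^ (k - 1)) * \<zeta> ^ Suc k) \<longlongrightarrow> 0) (at_right 0)"
      using k by (simp add: zero_power)
    then show "((\<lambda>t. (g (x + t *\<^sub>R L \<zeta>) - g x) /\<^sub>R t\<^sup>2) \<longlongrightarrow> 0) (at_right 0)"
    proof (rule Lim_transform_eventually)
      have "of_real (t ^ (k - 1)) * \<zeta> ^ Suc k = (g (x + t *\<^sub>R L \<zeta>) - g x) /\<^sub>R t\<^sup>2" if "t > 0" for t :: real
      proof -
        have "t ^ Suc k = t ^ (k - 1) * t\<^sup>2" using k by (simp flip: power_add)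
        then have "t ^ (k - 1) = t ^ Suc k / t\<^sup>2" using that by simp
        then show ?thesis
          unfolding flat power_mult_distrib scaleR_conv_of_real by (simp add: divide_inverse mult_ac)
      qed
      then show "eventually (\<lambda>t. of_real (t ^ (k - 1)) * \<zeta> ^ Suc k = (g (x + t *\<^sub>R L \<zeta>) - g x) /\<^sub>R t\<^sup>2) (at_right 0)"
        using eventually_at_right_less[of 0] by (auto elim!: eventually_mono)
    qed
  qed
qed

text \<open>Choosing \<open>v ^ n = cnj c / norm c\<close> makes \<open>c * v ^ n\<close> equal to
  \<open>norm c\<close>. This yields points of a critical curve that are not cusps.\<close>

lemma Re_mult_power_nonzero:
  assumes "c \<noteq> 0" "n > 0"
  obtains v where "norm v = 1" "Re (c * v ^ n) \<noteq> 0"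
proof -
  obtain v where v: "v ^ n = cnj c / norm c"
    using card_nth_roots[of "cnj c / norm c" n] assms by (metis (mono_tags, lifting) Collect_empty_eq card.empty complex_cnj_zero_iff divide_eq_0_iff norm_eq_zero of_real_eq_0_iff neq0_conv)
  have "norm v ^ n = 1" using v assms(1) by (simp add: norm_divide flip: norm_power)
  then have "norm v = 1" using assms(2) power_eq_1_iff[of "norm v" n] by simp
  moreover have "c * v ^ n = norm c"
    using v assms(1) by (simp add: power2_eq_square flip: complex_norm_square)
  then have "Re (c * v ^ n) \<noteq> 0" using assms(1) by simp
  ultimately show ?thesis using that by blast
qed

text \<open>For \<open>a = 0\<close> the critical set lies in \<open>z = 0\<close>. Through a
  critical point that is not a cusp, the map varies along the \<open>z\<close>-plane by
  \<open>\<zeta> ^ (P + 1)\<close>, which is too flat for a fold if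
  \<open>P \<ge> 2\<close>.\<close>

lemma excellent_zero_coeff_first_exponent:
  assumes exc: "excellent (mixed_map P Q 0 b)" and P: "P > 0" and Q: "Q > 0" and b: "b \<noteq> 0"
  shows "P = 1"
proof (rule ccontr)
  assume "P \<noteq> 1"
  then have P2: "P \<ge> 2" using P by simp
  have z: "0 \<in> base_roots P 0" using P by (simp add: base_roots_def)
  obtain w where w: "w \<in> base_roots Q b"
    using card_base_roots[OF b Q] Q by (metis card.empty ex_in_conv less_irrefl)
  have "w \<noteq> 0" using w b Q by (auto simp: base_roots_def zero_power)
  then obtain v where v: "norm v = 1" "Re (of_nat P * cnj b * w * v ^ (P * (Q + 2))) \<noteq> 0"
    using Re_mult_power_nonzero[of "of_nat P * cnj b * w" "P * (Q + 2)"] b P by auto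
  let ?x = "crit_curve P Q 0 w v"
  have "?x \<notin> cusps (mixed_map P Q 0 b)"
    using crit_curve_cusp_iff[OF exc P Q _ z w v(1)] b v(2) by simp
  moreover have "linear (\<lambda>\<zeta>::complex. (\<zeta>, 0::complex))" "inj (\<lambda>\<zeta>::complex. (\<zeta>, 0::complex))"
    by (auto simp: linear_iff inj_def)
  ultimately show False
    by (rule excellent_not_flat[OF exc critical_crit_curve[OF z w v(1)] _ _ _ _ P2])
       (simp add: crit_curve_def mixed_map_def scaleR_conv_of_real)
qed

text \<open>The same argument with the roles of \<open>z\<close> and \<open>w\<close>
  exchanged.\<close>

lemma excellent_zero_coeff_second_exponent:
  assumes exc: "excellent (mixed_map P Q a 0)" and P: "P > 0" and Q: "Q > 0" and a: "a \<noteq> 0"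
  shows "Q = 1"
proof (rule ccontr)
  assume "Q \<noteq> 1"
  then have Q2: "Q \<ge> 2" using Q by simp
  have w: "0 \<in> base_roots Q 0" using Q by (simp add: base_roots_def)
  obtain z where z: "z \<in> base_roots P a"
    using card_base_roots[OF a P] P by (metis card.empty ex_in_conv less_irrefl)
  have "z \<noteq> 0" using z a P by (auto simp: base_roots_def zero_power)
  then obtain v where v: "norm v = 1" "Re (of_nat Q * cnj a * z * v ^ ((P + 2) * Q)) \<noteq> 0"
    using Re_mult_power_nonzero[of "of_nat Q * cnj a * z" "(P + 2) * Q"] a Q by auto
  let ?x = "crit_curve P Q z 0 v"
  have "?x \<notin> cusps (mixed_map P Q a 0)"
    using crit_curve_cusp_iff[OF exc P Q _ z w v(1)] a v(2) by simp
  moreover have "linear (\<lambda>\<zeta>::complex. (0::complex, \<zeta>))" "inj (\<lambda>\<zeta>::complex. (0::complex, \<zeta>))"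
    by (auto simp: linear_iff inj_def)
  ultimately show False
    by (rule excellent_not_flat[OF exc critical_crit_curve[OF z w v(1)] _ _ _ _ Q2])
       (simp add: crit_curve_def mixed_map_def scaleR_conv_of_real)
qed

text \<open>Every normal form has first component \<open>x1\<close>, so its derivative at the origin
  does not kill the first basis vector.\<close>

lemma excellent_derivative_nonzero:
  assumes exc: "excellent g" and G: "(g has_derivative G) (at x)"
  shows "G \<noteq> (\<lambda>h. 0)"
proof -
  have reg: "(regular_nf has_derivative regular_nf) (at 0)" "regular_nf (1, 0, 0, 0) \<noteq> 0"
    using has_derivative_regular_nf by (auto simp: regular_nf_def zero_prod_def)
  have fold: "\<exists>N'. (fold_nf e has_derivative N') (at 0) \<and> N' (1, 0, 0, 0) \<noteq> 0" for e
    using has_derivative_fold_nf[of e 0 0 0 0] by (intro exI conjI) (auto simp: zero_prod_def)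
  have cusp: "\<exists>N'. (cusp_nf s has_derivative N') (at 0) \<and> N' (1, 0, 0, 0) \<noteq> 0" for s
    using has_derivative_cusp_nf[of s 0 0 0 0] by (intro exI conjI) (auto simp: zero_prod_def)
  have "has_normal_form_at g regular_nf x \<or> (\<exists>e. has_normal_form_at g (fold_nf e) x) \<or> (\<exists>s. has_normal_form_at g (cusp_nf s) x)"
    using exc unfolding excellent_def is_cusp_point_def def_fold_nf_eq indef_fold_nf_eq by blast
  then show ?thesis
    using normal_form_derivative_nonzero[OF _ G] reg fold cusp by metis
qed

theorem theorem1p2:
  fixes p q :: nat and a b :: complex
  assumes "2 \<le> q" and "q \<le> p"
    and "excellent (\<lambda>(z, w). z ^ p + w ^ q + a * cnj z + b * cnj w)"
  shows "finite (cusps (\<lambda>(z, w). z ^ p + w ^ q + a * cnj z + b * cnj w)) \<and>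
         (p + 1) * (q - 1) \<le> card (cusps (\<lambda>(z, w). z ^ p + w ^ q + a * cnj z + b * cnj w)) \<and>
         card (cusps (\<lambda>(z, w). z ^ p + w ^ q + a * cnj z + b * cnj w)) \<le> (p - 1) * (q + 1) \<and>
         (p = q \<longrightarrow> card (cusps (\<lambda>(z, w). z ^ p + w ^ q + a * cnj z + b * cnj w)) = p ^ 2 - 1)"
proof -
  obtain P Q where p: "p = Suc P" and q: "q = Suc Q" and P: "P > 0" and Q: "Q > 0" and PQ: "Q \<le> P"
    using assms(1,2) by (cases p; cases q) auto
  have F: "(\<lambda>(z, w). z ^ p + w ^ q + a * cnj z + b * cnj w) = mixed_map P Q a b"
    by (simp only: mixed_map_def p q)
  have exc: "excellent (mixed_map P Q a b)" using assms(3) unfolding F .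
  \<comment> \<open>For \<open>a = b = 0\<close> the derivative would vanish at the origin, both
    exponents being at least two.\<close>
  have ab: "a \<noteq> 0 \<or> b \<noteq> 0"
  proof (rule ccontr)
    assume "\<not> (a \<noteq> 0 \<or> b \<noteq> 0)"
    then have "(\<lambda>(h, k). of_nat (Suc P) * 0 ^ P * h + of_nat (Suc Q) * 0 ^ Q * k + a * cnj h + b * cnj k) = (\<lambda>h. 0)"
      using P Q by (auto simp: fun_eq_iff zero_power)
    then show False using excellent_derivative_nonzero[OF exc has_derivative_mixed_map[of P Q a b 0 0]] by blast
  qed
  \<comment> \<open>If \<open>a = 0\<close> the only base root is \<open>0\<close>, and the count is
    still \<open>P\<close> because \<open>P = 1\<close> is forced.\<close>
  have ca: "card (base_roots P a) = P"
  proof (cases "a = 0")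
    case True
    then have "P = 1" using excellent_zero_coeff_first_exponent exc P Q ab by blast
    then show ?thesis using True by (simp add: base_roots_def)
  qed (use card_base_roots P in blast)
  have cb: "card (base_roots Q b) = Q"
  proof (cases "b = 0")
    case True
    then have "Q = 1" using excellent_zero_coeff_second_exponent exc P Q ab by blast
    then show ?thesis using True by (simp add: base_roots_def)
  qed (use card_base_roots Q in blast)
  note card = card_cusps_mixed_map[OF exc P Q ab PQ ca cb]
  \<comment> \<open>The two bounds coincide: both are
    \<open>P * (P + 2) = (p - 1) * (p + 1)\<close>.\<close>
  have "card (cusps (mixed_map P Q a b)) = p\<^sup>2 - 1" if "p = q"
    using card(2,3) that p q by (simp add: power2_eq_square algebra_simps)
  then show ?thesis unfolding F using card p q by simp
qed

end
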